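(* A point in $U$ constitutes a vertex of $P_\lambda$ if and only if it has the form $\sum_{i=1}^n a_i\chi_{A_i}$ for a tuple of $\preceq$-antichains $(A_i\subset Q^C_i,\ 1\le i\le n)$ such that for all $1\le i\le n-1$ the point $\chi_{A_i}+\chi_{A_{i+1}}$ constitutes a vertex of the $\mathfrak{sl}_{2n}$ FFLV polytope $P_{\omega^A_i+\omega^A_{i+1}}$.
   Context: Let $\lambda$ be a dominant integral weight of $\mathfrak{sp}_{2n}$ with coordinates $(a_1,\ldots,a_n)$ in the basis of fundamental weights (simple roots $\alpha_1,\ldots,\alpha_n$ with $(\alpha_i,\alpha_{i+1})<0$ and $\alpha_n$ long). Let $U=\mathbb R^{n^2}$ with coordinates $x_{i,j}$ labeled by pairs $1\le i<j\le 2n+1-i$. A type $C$ Dyck path is a sequence $d=((i_1,j_1),\ldots,(i_N,j_N))$ of such pairs with $j_1-i_1=1$, each $(i_{k+1},j_{k+1})$ equal to $(i_k+1,j_k)$ or $(i_k,j_k+1)$, and either $j_N-i_N=1$ or $i_N+j_N=2n+1$. Set $S(x,d)=\sum_{(i,j)\in d}x_{i,j}$, and $M(\lambda,d)=a_{i_1}+\ldots+a_{i_N}$ if $j_N-i_N=1$, $M(\lambda,d)=a_{i_1}+\ldots+a_n$ otherwise. The type $C$ FFLV polytope $P_\lambda\subset U$ is the set of $x$ with all $x_{i,j}\ge 0$ and $S(x,d)\le M(\lambda,d)$ for every type $C$ Dyck path $d$. For $\mathfrak{sl}_{2n}$ with fundamental weights $\omega^A_1,\ldots,\omega^A_{2n-1}$,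 let $U_A=\mathbb R^{n(2n-1)}$ with coordinates labeled by pairs $1\le i<j\le 2n$; for a dominant integral weight $\mu=\sum b_i\omega^A_i$ the (type $A$) FFLV polytope $P_\mu\subset U_A$ is the set of $x$ with all $x_{i,j}\ge0$ and $\sum_{(i,j)\in d}x_{i,j}\le b_{i_1}+b_{i_1+1}+\ldots+b_{i_N}$ for every type $A$ Dyck path $d=((i_1,j_1),\ldots,(i_N,j_N))$ (pairs $1\le i<j\le 2n$, $j_1-i_1=j_N-i_N=1$, each step going to $(i_k+1,j_k)$ or $(i_k,j_k+1)$). $U$ is identified with the subspace of $U_A$ where all coordinates $x_{i,j}$ with $i+j>2n+1$ vanish. On pairs $1\le i<j\le 2n$ define the partial order $(i_1,j_1)\preceq(i_2,j_2)$ iff $i_1\le i_2$ and $j_1\le j_2$. For $1\le i\le 2n-1$ let $Q_i=\{(k,l):1\le k\le i,\ i+1\le l\le 2n\}$, and for $1\le i\le n$ let $Q^C_i=\{(k,l)\in Q_i: k+l\le 2n+1\}$. For a set $A$ of pairs, $\chi_A$ denotes its indicator function, viewed as a point of $U$ (or $U_A$). *)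

theory Defs
  imports "HOL-Analysis.Analysis" "HOL-Analysis.Finite_Function_Topology"
begin

text \<open>
  Points are finitely supported functions on pairs of naturals, which the library makes a real
  vector space. The coordinate space over a finite set I of pairs is the subspace of
  functions supported in I. The subspace of functions supported on the type C pairs thus literally
  lies inside the one for the type A pairs, so that the identification of U with the subspace of
  \<open>U\<^sub>A\<close> on which the coordinates with \<open>i + j > 2n + 1\<close> vanish is an inclusion.
\<close>

type_synonym point = "(nat \<times> nat) \<Rightarrow>\<^sub>0 real"

definition coord_space :: "(nat \<times> nat) set \<Rightarrow> point set" where
  "coord_space I = {x. Poly_Mapping.keys x \<subseteq> I}"

definition chi :: "(nat \<times> nat) set \<Rightarrow> point" where
  "chi A = (\<Sum>p\<in>A. Poly_Mapping.single p 1)"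

lemma lookup_chi:
  assumes "finite A"
  shows "Poly_Mapping.lookup (chi A) p = indicator A p"
  using assms
  by (simp add: chi_def Poly_Mapping.lookup_sum lookup_single when_def sum.delta' indicator_def)

definition pair_le :: "nat \<times> nat \<Rightarrow> nat \<times> nat \<Rightarrow> bool" (infix \<open>\<preceq>\<close> 50) where
  "p \<preceq> q \<longleftrightarrow> fst p \<le> fst q \<and> snd p \<le> snd q"

definition antichain :: "(nat \<times> nat) set \<Rightarrow> bool" where
  "antichain A \<longleftrightarrow> (\<forall>p\<in>A. \<forall>q\<in>A. p \<preceq> q \<longrightarrow> p = q)"

definition dyck_step :: "nat \<times> nat \<Rightarrow> nat \<times> nat \<Rightarrow> bool" where
  "dyck_step p q \<longleftrightarrow> q = (fst p + 1, snd p) \<or> q = (fst p, snd p + 1)"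

text \<open>Type A objects are indexed by m for \<open>sl\<^sub>m\<close>, type C objects by n for \<open>sp\<^sub>2\<^sub>n\<close>.\<close>

definition pairsA :: "nat \<Rightarrow> (nat \<times> nat) set" where
  "pairsA m = {(i, j). 1 \<le> i \<and> i < j \<and> j \<le> m}"

definition pairsC :: "nat \<Rightarrow> (nat \<times> nat) set" where
  "pairsC n = {(i, j). 1 \<le> i \<and> i < j \<and> i + j \<le> 2 * n + 1}"

definition dyck_pathA :: "nat \<Rightarrow> (nat \<times> nat) list \<Rightarrow> bool" where
  "dyck_pathA m d \<longleftrightarrow>
     d \<noteq> [] \<and> set d \<subseteq> pairsA m \<and> successively dyck_step d \<and>
     snd (hd d) = fst (hd d) + 1 \<and> snd (last d) = fst (last d) + 1"

definition dyck_pathC :: "nat \<Rightarrow> (nat \<times> nat) list \<Rightarrow> bool" where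
  "dyck_pathC n d \<longleftrightarrow>
     d \<noteq> [] \<and> set d \<subseteq> pairsC n \<and> successively dyck_step d \<and>
     snd (hd d) = fst (hd d) + 1 \<and>
     (snd (last d) = fst (last d) + 1 \<or> fst (last d) + snd (last d) = 2 * n + 1)"

text \<open>The elements of a Dyck path are pairwise distinct, hence the sum over the set.\<close>

definition path_sum :: "point \<Rightarrow> (nat \<times> nat) list \<Rightarrow> real" where
  "path_sum x d = (\<Sum>p\<in>set d. Poly_Mapping.lookup x p)"

text \<open>
  A dominant integral weight is given by its coordinates in the basis of fundamental weights, which
  are natural numbers; only the values at \<open>1, \<dots>, n\<close> (for \<open>sp\<^sub>2\<^sub>n\<close>) or \<open>1, \<dots>, m - 1\<close>
  (for \<open>sl\<^sub>m\<close>) are ever used.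
\<close>

type_synonym weight = "nat \<Rightarrow> nat"

definition omegaA :: "nat \<Rightarrow> weight" where
  "omegaA i = (\<lambda>k. if k = i then 1 else 0)"

definition boundA :: "weight \<Rightarrow> (nat \<times> nat) list \<Rightarrow> nat" where
  "boundA b d = (\<Sum>k = fst (hd d)..fst (last d). b k)"

definition boundC :: "nat \<Rightarrow> weight \<Rightarrow> (nat \<times> nat) list \<Rightarrow> nat" where
  "boundC n a d =
     (if snd (last d) = fst (last d) + 1
      then \<Sum>k = fst (hd d)..fst (last d). a k
      else \<Sum>k = fst (hd d)..n. a k)"

definition FFLV_A :: "nat \<Rightarrow> weight \<Rightarrow> point set" where
  "FFLV_A m b =
     {x \<in> coord_space (pairsA m).
        (\<forall>p\<in>pairsA m. 0 \<le> Poly_Mapping.lookup x p) \<and>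
        (\<forall>d. dyck_pathA m d \<longrightarrow> path_sum x d \<le> real (boundA b d))}"

definition FFLV_C :: "nat \<Rightarrow> weight \<Rightarrow> point set" where
  "FFLV_C n a =
     {x \<in> coord_space (pairsC n).
        (\<forall>p\<in>pairsC n. 0 \<le> Poly_Mapping.lookup x p) \<and>
        (\<forall>d. dyck_pathC n d \<longrightarrow> path_sum x d \<le> real (boundC n a d))}"

definition Q :: "nat \<Rightarrow> nat \<Rightarrow> (nat \<times> nat) set" where
  "Q m i = {(k, l). 1 \<le> k \<and> k \<le> i \<and> i + 1 \<le> l \<and> l \<le> m}"

definition QC :: "nat \<Rightarrow> nat \<Rightarrow> (nat \<times> nat) set" where
  "QC n i = {(k, l) \<in> Q (2 * n) i. k + l \<le> 2 * n + 1}"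

end

theory Submission
  imports Defs
begin

text \<open>
  The type C polytope is the face of a type A polytope on which the coordinates outside \<open>U\<close>
  vanish, so it suffices to describe the vertices of type A polytopes together with their supports.

  Every \<open>x\<close> in a type A polytope is the sequence of drops of a potential with value
  \<open>b\<^sub>i + b\<^sub>i\<^sub>+\<^sub>1 + \<dots>\<close> at \<open>(i, i)\<close>; the pairs at which the potential crosses a level \<open>t\<close> form an
  antichain inside some \<open>Q\<^sub>i\<close>, and \<open>x\<close> is the integral over \<open>t\<close> of their indicators. Hence a
  functional on \<open>P\<^sub>\<mu>\<close> is bounded by the sum of the \<open>b\<^sub>i\<close> times its maxima over antichains in \<open>Q\<^sub>i\<close>.
  For a generic functional exposing a vertex these maxima are attained at unique antichains, which
  form the required tuple.

  Conversely, if \<open>\<chi>\<^sub>A + \<chi>\<^sub>B\<close> is a vertex for two consecutive antichains, then no parts of \<open>A\<close> and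
  \<open>B\<close> can be exchanged. It follows that \<open>B\<close> lies above \<open>A\<close> and that a function on the symmetric
  difference which is constant along the relations \<open>p \<preceq> q\<close> and zero next to the position
  \<open>(i + 1, i + 1)\<close> vanishes. If \<open>v\<close> is a direction that keeps all tight constraints tight, then the
  sums of \<open>v\<close> over the two halves of tight chains give such functions for each \<open>i\<close>, and \<open>v = 0\<close>
  follows.
\<close>

section \<open>Extreme points of polyhedra\<close>

lemma extreme_point_of_symmetric_segment:
  assumes "x extreme_point_of S" "x + v \<in> S" "x - v \<in> S"
  shows "v = 0"
proof (rule ccontr)
  assume "v \<noteq> 0"
  moreover have "x = midpoint (x + v) (x - v)"
    by (simp add: midpoint_def scaleR_2[symmetric])
  moreover have "(x + v) - (x - v) = 2 *\<^sub>R v"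
    by (simp add: scaleR_2)
  ultimately have "x \<in> open_segment (x + v) (x - v)"
    by (metis midpoint_in_open_segment right_minus_eq scaleR_eq_0_iff zero_neq_numeral)
  then show False using assms by (auto simp: extreme_point_of_def)
qed

lemma extreme_point_of_unique_maximizer:
  fixes l :: "'v::real_vector \<Rightarrow> real"
  assumes "linear l" "x \<in> P" and max: "\<And>z. z \<in> P \<Longrightarrow> z \<noteq> x \<Longrightarrow> l z < l x"
  shows "x extreme_point_of P"
proof -
  have "x \<notin> open_segment y z" if "y \<in> P" "z \<in> P" for y z
  proof
    assume "x \<in> open_segment y z"
    then obtain u where u: "0 < u" "u < 1" "x = (1 - u) *\<^sub>R y + u *\<^sub>R z"
      and "x \<noteq> y" "x \<noteq> z"
      by (metis in_segment(2) open_segment_def Diff_iff insert_iff)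
    then have "l y < l x" "l z < l x" using that max by auto
    then have "(1 - u) * l y + u * l z < l x"
      using u by (intro convex_bound_lt) auto
    then show False
      using u(3) by (simp add: linear_add[OF assms(1)] linear_scale[OF assms(1)])
  qed
  then show ?thesis using assms(2) by (simp add: extreme_point_of_def)
qed

lemma convex_combination_eq_bound:
  fixes s t c u :: real
  assumes "s \<le> c" "t \<le> c" "0 < u" "u < 1" "(1 - u) * s + u * t = c"
  shows "s = c" "t = c"
proof -
  have "(1 - u) * (c - s) + u * (c - t) = 0" using assms(5) by (simp add: algebra_simps)
  moreover have "0 \<le> (1 - u) * (c - s)" "0 \<le> u * (c - t)" using assms by auto
  ultimately have "(1 - u) * (c - s) = 0" "u * (c - t) = 0" by linarith+
  then show "s = c" "t = c" using assms(3,4) by auto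
qed

lemma eventually_at_right_affine_pos:
  fixes a b :: real
  assumes "0 < a"
  shows "\<forall>\<^sub>F e in at_right 0. 0 < a + e * b"
proof (rule order_tendstoD(1)[OF _ assms])
  have "((\<lambda>e. a + e * b) \<longlongrightarrow> a + 0 * b) (at_right 0)" by (intro tendsto_intros)
  then show "((\<lambda>e. a + e * b) \<longlongrightarrow> a) (at_right 0)" by simp
qed

lemma eventually_at_right_affine_nonzero:
  fixes a b :: real
  assumes "a \<noteq> 0 \<or> b \<noteq> 0"
  shows "\<forall>\<^sub>F e in at_right 0. a + e * b \<noteq> 0"
proof (cases "b = 0")
  case False
  have "\<forall>\<^sub>F e in at_right 0. e \<noteq> - a / b" by (rule eventually_neq_at_within)
  then show ?thesis by (rule eventually_mono) (use False in \<open>auto simp: field_simps add_eq_0_iff2\<close>)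
qed (use assms in simp)

lemma eventually_at_right_obtain:
  fixes P :: "real \<Rightarrow> bool"
  assumes "\<forall>\<^sub>F e in at_right 0. P e"
  obtains e where "0 < e" "P e"
  using eventually_happens'[OF trivial_limit_at_right_real
      eventually_conj[OF eventually_at_right_less assms]] that by blast

definition solutions :: "'v::real_vector set \<Rightarrow> (('v \<Rightarrow> real) \<times> real) set \<Rightarrow> 'v set" where
  "solutions S C = {z \<in> S. \<forall>(l, c)\<in>C. l z \<le> c}"

locale linear_constraints =
  fixes S :: "'v::real_vector set" and C :: "(('v \<Rightarrow> real) \<times> real) set"
  assumes subspace_S: "subspace S" and finite_C: "finite C" and linear_C: "(l, c) \<in> C \<Longrightarrow> linear l"
begin

lemma extreme_point_tight_direction:
  assumes x: "x extreme_point_of solutions S C" and v: "v \<in> S"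
    and tight: "\<And>l c. (l, c) \<in> C \<Longrightarrow> l x = c \<Longrightarrow> l v = 0"
  shows "v = 0"
proof -
  have xP: "x \<in> S" "\<And>l c. (l, c) \<in> C \<Longrightarrow> l x \<le> c"
    using x by (auto simp: extreme_point_of_def solutions_def)
  have ev: "\<forall>\<^sub>F e in at_right 0. l x + e * l w \<le> c" if "(l, c) \<in> C" "l x = c \<Longrightarrow> l w = 0" for l c w
  proof (cases "l x = c")
    case False
    then have "\<forall>\<^sub>F e in at_right 0. 0 < (c - l x) + e * (- l w)"
      using xP(2)[OF that(1)] by (intro eventually_at_right_affine_pos) simp
    then show ?thesis by (rule eventually_mono) simp
  qed (use that in simp)
  have "l (- v) = 0" if "(l, c) \<in> C" "l x = c" for l c
    using tight[OF that] linear_neg[OF linear_C[OF that(1)], of v] by simp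
  then have "\<forall>\<^sub>F e in at_right 0. \<forall>(l, c)\<in>C. l x + e * l v \<le> c \<and> l x + e * l (- v) \<le> c"
    using finite_C ev tight
    by (intro eventually_ball_finite ballI) (auto intro!: eventually_conj)
  then obtain e where "0 < e" "\<forall>(l, c)\<in>C. l x + e * l v \<le> c \<and> l x + e * l (- v) \<le> c"
    by (rule eventually_at_right_obtain)
  then have "x + e *\<^sub>R v \<in> solutions S C" "x - e *\<^sub>R v \<in> solutions S C"
    using xP(1) v subspace_S linear_C
    by (auto simp: solutions_def subspace_add subspace_diff subspace_scale
        linear_add linear_diff linear_scale linear_neg)
  then show ?thesis
    using extreme_point_of_symmetric_segment[OF x, of "e *\<^sub>R v"] \<open>0 < e\<close> by simp
qed

lemma extreme_point_if_tight_directions_zero: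
  assumes x: "x \<in> solutions S C"
    and tight: "\<And>v. v \<in> S \<Longrightarrow> (\<And>l c. (l, c) \<in> C \<Longrightarrow> l x = c \<Longrightarrow> l v = 0) \<Longrightarrow> v = 0"
  shows "x extreme_point_of solutions S C"
proof -
  have "x \<notin> open_segment y z" if y: "y \<in> solutions S C" and z: "z \<in> solutions S C" for y z
  proof
    assume "x \<in> open_segment y z"
    then obtain u where u: "0 < u" "u < 1" "x = (1 - u) *\<^sub>R y + u *\<^sub>R z" and "y \<noteq> z"
      by (auto simp: in_segment)
    have "z - y = 0"
    proof (rule tight)
      show "z - y \<in> S" using y z subspace_S by (simp add: solutions_def subspace_diff)
      fix l c assume l: "(l, c) \<in> C" "l x = c"
      then have "l y \<le> c" "l z \<le> c" using y z by (auto simp: solutions_def)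
      moreover have "(1 - u) * l y + u * l z = c"
        using l u(3) by (simp add: linear_C[OF l(1)] linear_add linear_scale)
      ultimately have "l y = c" "l z = c" using convex_combination_eq_bound u(1,2) by blast+
      then show "l (z - y) = 0" by (simp add: linear_C[OF l(1)] linear_diff)
    qed
    then show False using \<open>y \<noteq> z\<close> by simp
  qed
  then show ?thesis using x by (simp add: extreme_point_of_def)
qed

lemma convex_solutions: "convex (solutions S C)"
proof -
  have "solutions S C = S \<inter> (\<Inter>(l, c)\<in>C. l -` {..c})" by (auto simp: solutions_def)
  moreover have "convex (l -` {..c})" if "(l, c) \<in> C" for l c
    using that by (intro convex_linear_vimage linear_C) auto
  ultimately show ?thesis
    using subspace_imp_convex[OF subspace_S] by (auto intro!: convex_Int convex_INT)
qed

text \<open>The sum of the constraint functionals that are tight at a vertex exposes it.\<close>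

lemma extreme_point_exposed:
  assumes x: "x extreme_point_of solutions S C"
  obtains l :: "'v \<Rightarrow> real" where "linear l" "\<And>z. z \<in> solutions S C \<Longrightarrow> z \<noteq> x \<Longrightarrow> l z < l x"
proof
  define T where "T = {lc \<in> C. fst lc x = snd lc}"
  have "finite T" using finite_C by (simp add: T_def)
  show "linear (\<lambda>z. \<Sum>lc\<in>T. fst lc z)"
    by (rule linear_compose_sum) (auto simp: T_def linear_C)
  fix z assume z: "z \<in> solutions S C" "z \<noteq> x"
  have le: "fst lc z \<le> fst lc x" if "lc \<in> T" for lc
    using that z(1) by (auto simp: T_def solutions_def)
  have "\<exists>lc\<in>T. fst lc z \<noteq> fst lc x"
  proof (rule ccontr)
    assume eq: "\<not> ?thesis"
    have "z - x = 0"
    proof (rule extreme_point_tight_direction[OF x])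
      show "z - x \<in> S"
        using x z subspace_S by (simp add: extreme_point_of_def solutions_def subspace_diff)
      show "l (z - x) = 0" if "(l, c) \<in> C" "l x = c" for l c
        using eq that by (force simp: T_def linear_C[OF that(1)] linear_diff)
    qed
    then show False using z(2) by simp
  qed
  then show "(\<Sum>lc\<in>T. fst lc z) < (\<Sum>lc\<in>T. fst lc x)"
    using \<open>finite T\<close> le by (intro sum_strict_mono_ex1) (auto simp: order.strict_iff_order)
qed

end

section \<open>The pairing of points with coordinate weights\<close>

abbreviation coeff_at :: "('a \<Rightarrow>\<^sub>0 real) \<Rightarrow> 'a \<Rightarrow> real" where
  "coeff_at \<equiv> Poly_Mapping.lookup"

definition pairing :: "('a \<Rightarrow> real) \<Rightarrow> ('a \<Rightarrow>\<^sub>0 real) \<Rightarrow> real" where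
  "pairing w x = (\<Sum>p\<in>Poly_Mapping.keys x. w p * coeff_at x p)"

lemma lookup_scaleR: "coeff_at (c *\<^sub>R x) p = c * coeff_at x p"
proof -
  have "finite {i. c *\<^sub>R coeff_at x i \<noteq> 0}"
    by (rule finite_subset[OF _ finite_keys[of x]]) (auto simp: in_keys_iff)
  then show ?thesis by (simp add: scaleR_poly_mapping_def)
qed

lemma pairing_eq_sum:
  assumes "finite I" "Poly_Mapping.keys x \<subseteq> I"
  shows "pairing w x = (\<Sum>p\<in>I. w p * coeff_at x p)"
  unfolding pairing_def using assms
  by (intro sum.mono_neutral_left) (auto simp: in_keys_iff)

lemma linear_pairing: "linear (pairing w)"
proof (rule linearI)
  fix x y :: "'a \<Rightarrow>\<^sub>0 real"
  let ?I = "Poly_Mapping.keys x \<union> Poly_Mapping.keys y"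
  have "pairing w (x + y) = (\<Sum>p\<in>?I. w p * coeff_at (x + y) p)"
    using keys_add[of x y] by (intro pairing_eq_sum) auto
  also have "\<dots> = pairing w x + pairing w y"
    by (simp add: pairing_eq_sum[of ?I] lookup_add distrib_left sum.distrib)
  finally show "pairing w (x + y) = pairing w x + pairing w y" .
next
  fix c and x :: "'a \<Rightarrow>\<^sub>0 real"
  have "pairing w (c *\<^sub>R x) = (\<Sum>p\<in>Poly_Mapping.keys x. w p * coeff_at (c *\<^sub>R x) p)"
    by (intro pairing_eq_sum) (auto simp: in_keys_iff lookup_scaleR)
  then show "pairing w (c *\<^sub>R x) = c *\<^sub>R pairing w x"
    by (simp add: pairing_def lookup_scaleR sum_distrib_left mult.left_commute)
qed

lemmas pairing_diff = linear_diff[OF linear_pairing]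
  and pairing_scaleR = linear_scale[OF linear_pairing]
  and pairing_sum = linear_sum[OF linear_pairing]

lemma pairing_perturb: "pairing (\<lambda>p. w p + e * u p) x = pairing w x + e * pairing u x"
  by (simp add: pairing_def distrib_right sum.distrib sum_distrib_left mult.assoc)

lemma pairing_minus_weight: "pairing (\<lambda>p. - w p) x = - pairing w x"
  by (simp add: pairing_def sum_negf)

lemma pairing_cong: "(\<And>p. p \<in> Poly_Mapping.keys x \<Longrightarrow> w p = u p) \<Longrightarrow> pairing w x = pairing u x"
  by (simp add: pairing_def)

lemma pairing_single: "pairing w (Poly_Mapping.single p c) = w p * c"
  by (simp add: pairing_def)

lemma pairing_indicator: "pairing (indicator B) x = (\<Sum>p\<in>B. coeff_at x p)" if "finite B"
proof -
  have "pairing (indicator B) x = (\<Sum>p\<in>Poly_Mapping.keys x \<union> B. indicator B p * coeff_at x p)"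
    using that by (intro pairing_eq_sum) auto
  also have "\<dots> = (\<Sum>p\<in>B. coeff_at x p)"
    using that by (intro sum.mono_neutral_cong_right) (auto simp: indicator_def)
  finally show ?thesis .
qed

lemma sum_single_keys: "(\<Sum>p\<in>Poly_Mapping.keys x. coeff_at x p *\<^sub>R Poly_Mapping.single p 1) = x"
  by (rule poly_mapping_eqI)
    (auto simp: lookup_sum lookup_scaleR lookup_single when_def in_keys_iff if_distrib
      cong: if_cong)

lemma linear_functional_eq_pairing:
  assumes "linear l"
  shows "l x = pairing (\<lambda>p. l (Poly_Mapping.single p 1)) x"
proof -
  have "l x = l (\<Sum>p\<in>Poly_Mapping.keys x. coeff_at x p *\<^sub>R Poly_Mapping.single p 1)"
    by (simp add: sum_single_keys)
  also have "\<dots> = pairing (\<lambda>p. l (Poly_Mapping.single p 1)) x"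
    by (simp add: linear_sum[OF assms] linear_scale[OF assms] pairing_def mult.commute)
  finally show ?thesis .
qed

text \<open>Finitely many hyperplanes do not cover any neighbourhood of a functional.\<close>

lemma exists_generic_functional:
  fixes w :: "'a \<Rightarrow> real"
  assumes "finite E" "0 \<notin> E" "finite D" "\<And>y. y \<in> D \<Longrightarrow> 0 < pairing w y"
  shows "\<exists>w'. (\<forall>y\<in>D. 0 < pairing w' y) \<and> (\<forall>y\<in>E. pairing w' y \<noteq> 0)"
  using assms(1,2)
proof (induction E rule: finite_induct)
  case empty
  then show ?case using assms(4) by blast
next
  case (insert z E)
  then obtain w' where w': "\<And>y. y \<in> D \<Longrightarrow> 0 < pairing w' y" "\<And>y. y \<in> E \<Longrightarrow> pairing w' y \<noteq> 0"
    by auto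
  obtain p where "coeff_at z p \<noteq> 0"
    using insert.prems poly_mapping_eqI[of z 0] by auto
  then have p: "pairing (indicator {p}) z \<noteq> 0" by (simp add: pairing_indicator)
  define W where "W e q = w' q + e * indicator {p} q" for e q
  have W: "pairing (W e) y = pairing w' y + e * pairing (indicator {p}) y" for e y
    unfolding W_def by (rule pairing_perturb)
  have "\<forall>\<^sub>F e in at_right 0. \<forall>y\<in>D. 0 < pairing (W e) y"
    unfolding W using assms(3) w'(1)
    by (intro eventually_ball_finite ballI eventually_at_right_affine_pos)
  moreover have "\<forall>\<^sub>F e in at_right 0. \<forall>y\<in>insert z E. pairing (W e) y \<noteq> 0"
    unfolding W using insert.hyps w'(2) p
    by (intro eventually_ball_finite ballI eventually_at_right_affine_nonzero) auto
  ultimately have "\<forall>\<^sub>F e in at_right 0.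
      (\<forall>y\<in>D. 0 < pairing (W e) y) \<and> (\<forall>y\<in>insert z E. pairing (W e) y \<noteq> 0)"
    by (rule eventually_conj)
  then show ?case by (rule eventually_at_right_obtain) blast
qed

section \<open>Chains, antichains and lattice paths\<close>

lemma pair_le_refl [simp]: "p \<preceq> p"
  by (simp add: pair_le_def)

lemma pair_le_trans: "p \<preceq> q \<Longrightarrow> q \<preceq> r \<Longrightarrow> p \<preceq> r"
  by (auto simp: pair_le_def)

lemma pair_le_antisym: "p \<preceq> q \<Longrightarrow> q \<preceq> p \<Longrightarrow> p = q"
  by (auto simp: pair_le_def prod_eq_iff)

lemma antichainD: "antichain A \<Longrightarrow> p \<in> A \<Longrightarrow> q \<in> A \<Longrightarrow> p \<preceq> q \<Longrightarrow> p = q"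
  by (auto simp: antichain_def)

lemma antichain_between_eq:
  assumes "antichain A" "p \<in> A" "q \<in> A" "p \<preceq> r" "r \<preceq> q"
  shows "r = q"
  using antichainD[OF assms(1-3)] assms(4,5) pair_le_trans pair_le_antisym by blast

abbreviation pair_chain :: "(nat \<times> nat) set \<Rightarrow> bool" where
  "pair_chain \<equiv> Complete_Partial_Order.chain (\<preceq>)"

lemma pair_chain_meets_antichain_once:
  assumes "pair_chain C" "antichain A" "p \<in> C \<inter> A" "q \<in> C \<inter> A"
  shows "p = q"
  using chainD[OF assms(1), of p q] antichainD[OF assms(2)] assms(3,4) by (metis IntE)

lemma card_pair_chain_Int_antichain:
  assumes "pair_chain C" "antichain A"
  shows "card (C \<inter> A) = of_bool (C \<inter> A \<noteq> {})"
proof (cases "C \<inter> A = {}")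
  case False
  then obtain p where "p \<in> C \<inter> A" by blast
  then have "C \<inter> A = {p}"
    using pair_chain_meets_antichain_once[OF assms] by blast
  then show ?thesis by simp
qed simp

lemma finite_pairsA: "finite (pairsA m)"
  by (rule finite_subset[of _ "{..m} \<times> {..m}"]) (auto simp: pairsA_def)

lemma Q_subset_pairsA: "Q m i \<subseteq> pairsA m"
  by (auto simp: Q_def pairsA_def)

lemma finite_Q: "finite (Q m i)"
  using finite_subset[OF Q_subset_pairsA finite_pairsA] .

lemma dyck_steps_sorted:
  assumes "successively dyck_step d"
  shows "sorted_wrt (\<lambda>p q. p \<preceq> q \<and> p \<noteq> q) d"
proof -
  have "successively (\<lambda>p q. p \<preceq> q \<and> p \<noteq> q) d"
    using assms by (rule successively_mono) (auto simp: dyck_step_def pair_le_def prod_eq_iff)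
  moreover have "transp (\<lambda>p q. p \<preceq> q \<and> p \<noteq> q)"
    by (auto simp: transp_def pair_le_def prod_eq_iff)
  ultimately show ?thesis
    by (simp add: successively_conv_sorted_wrt)
qed

lemma dyck_steps_distinct: "successively dyck_step d \<Longrightarrow> distinct d"
  by (drule dyck_steps_sorted) (induction d; auto)

lemma dyck_steps_chain: "successively dyck_step d \<Longrightarrow> pair_chain (set d)"
  by (drule dyck_steps_sorted) (induction d; auto simp: Complete_Partial_Order.chain_def)

lemma dyck_steps_hd_le: "successively dyck_step d \<Longrightarrow> p \<in> set d \<Longrightarrow> hd d \<preceq> p"
  by (drule dyck_steps_sorted) (cases d; auto)

lemma dyck_steps_le_last: "successively dyck_step d \<Longrightarrow> p \<in> set d \<Longrightarrow> p \<preceq> last d"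
  by (drule dyck_steps_sorted) (induction d; auto)

definition lattice_path :: "nat \<Rightarrow> nat \<times> nat \<Rightarrow> nat \<times> nat \<Rightarrow> (nat \<times> nat) list \<Rightarrow> bool" where
  "lattice_path m p q d \<longleftrightarrow>
     d \<noteq> [] \<and> set d \<subseteq> pairsA m \<and> successively dyck_step d \<and> hd d = p \<and> last d = q"

lemma lattice_path_between:
  assumes "lattice_path m p q d" "r \<in> set d"
  shows "p \<preceq> r" "r \<preceq> q"
  using assms dyck_steps_hd_le[of d r] dyck_steps_le_last[of d r] by (auto simp: lattice_path_def)

lemma lattice_path_endpoints:
  assumes "lattice_path m p q d"
  shows "p \<in> set d" "q \<in> set d" "p \<in> pairsA m" "q \<in> pairsA m"
  using assms by (auto simp: lattice_path_def)

lemma lattice_path_chain: "lattice_path m p q d \<Longrightarrow> pair_chain (set d)"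
  by (auto simp: lattice_path_def intro: dyck_steps_chain)

lemma finite_dyck_steps: "finite {d. set d \<subseteq> pairsA m \<and> successively dyck_step d}"
  by (rule finite_subset[OF _ finite_subset_distinct[OF finite_pairsA[of m]]])
    (auto simp: dyck_steps_distinct)

lemma lattice_path_append:
  assumes d: "lattice_path m p q d" and e: "lattice_path m q r e"
  obtains c where "lattice_path m p r c" "set c = set d \<union> set e"
proof -
  obtain e' where e': "e = q # e'" using e by (cases e) (auto simp: lattice_path_def)
  have "lattice_path m p r (d @ e')"
    using d e by (cases e') (auto simp: e' lattice_path_def successively_append_iff)
  moreover have "set (d @ e') = set d \<union> set e"
    using lattice_path_endpoints(2)[OF d] by (auto simp: e')
  ultimately show thesis by (rule that)
qed

lemma lattice_path_exists:
  assumes "p \<in> pairsA m" "q \<in> pairsA m" "p \<preceq> q"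
  obtains d where "lattice_path m p q d"
proof -
  have "\<exists>d. lattice_path m p q d"
    using assms(2,3)
  proof (induction "fst q + snd q" arbitrary: q rule: less_induct)
    case less
    show ?case
    proof (cases "p = q")
      case True
      then show ?thesis
        using less.prems(1) by (intro exI[of _ "[q]"]) (simp add: lattice_path_def)
    next
      case False
      define r where "r = (if fst p < fst q then (fst q - 1, snd q) else (fst q, snd q - 1))"
      have "r \<in> pairsA m" "p \<preceq> r" "dyck_step r q" "fst r + snd r < fst q + snd q"
        using less.prems assms(1) False
        by (auto simp: r_def pairsA_def pair_le_def dyck_step_def prod_eq_iff)
      moreover from this obtain d where "lattice_path m p r d" using less.hyps by blast
      ultimately have "lattice_path m p q (d @ [q])"
        using less.prems(1) by (auto simp: lattice_path_def successively_append_iff)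
      then show ?thesis ..
    qed
  qed
  then show thesis using that by blast
qed

lemma lattice_path_through_chain:
  assumes "finite C" "pair_chain C" "C \<subseteq> pairsA m" "\<And>u. u \<in> C \<Longrightarrow> p \<preceq> u \<and> u \<preceq> q"
    and "p \<in> pairsA m" "q \<in> pairsA m" "p \<preceq> q"
  obtains d where "lattice_path m p q d" "C \<subseteq> set d"
proof -
  have "\<exists>d. lattice_path m p q d \<and> C \<subseteq> set d"
    using assms(1-4,6,7)
  proof (induction C arbitrary: q rule: finite_ranking_induct[where f = "\<lambda>u. fst u + snd u"])
    case empty
    then show ?case using lattice_path_exists[OF assms(5)] by blast
  next
    case (insert u C)
    have "v \<preceq> u" if "v \<in> C" for v
    proof -
      have "v \<preceq> u \<or> u \<preceq> v"
        using that chainD[OF insert.prems(1), of v u] by auto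
      moreover have "fst v + snd v \<le> fst u + snd u" using that by (rule insert.hyps)
      ultimately show ?thesis by (auto simp: pair_le_def)
    qed
    then obtain d where "lattice_path m p u d" "C \<subseteq> set d"
      using insert.IH[of u] insert.prems chain_subset[OF insert.prems(1), of C] by auto
    moreover obtain e where "lattice_path m u q e"
      using insert.prems lattice_path_exists[of u m q] by auto
    ultimately show ?case
      using lattice_path_endpoints(2) by (blast elim: lattice_path_append)
  qed
  then show thesis using that by blast
qed

lemma dyck_pathA_lattice_path:
  assumes "dyck_pathA m d"
  shows "lattice_path m (fst (hd d), fst (hd d) + 1) (fst (last d), fst (last d) + 1) d"
  using assms unfolding dyck_pathA_def lattice_path_def by (metis prod.collapse)

lemma lattice_path_dyck_pathA:
  "lattice_path m (r, r + 1) (s, s + 1) d \<Longrightarrow> dyck_pathA m d"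
  by (auto simp: dyck_pathA_def lattice_path_def)

lemma dyck_pathA_meets_Q:
  assumes "dyck_pathA m d" "p \<in> set d" "p \<in> Q m i"
  shows "i \<in> {fst (hd d)..fst (last d)}"
  using lattice_path_between[OF dyck_pathA_lattice_path[OF assms(1)] assms(2)] assms(3)
  by (auto simp: pair_le_def Q_def)

section \<open>The type A polytope\<close>

lemma coeff_at_eq_0: "x \<in> coord_space I \<Longrightarrow> p \<notin> I \<Longrightarrow> coeff_at x p = 0"
  by (auto simp: coord_space_def in_keys_iff)

lemma coord_spaceI: "(\<And>p. p \<notin> I \<Longrightarrow> coeff_at x p = 0) \<Longrightarrow> x \<in> coord_space I"
  by (auto simp: coord_space_def in_keys_iff)

lemma subspace_coord_space: "subspace (coord_space I)"
  unfolding subspace_def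
  by (auto intro!: coord_spaceI simp: coeff_at_eq_0 lookup_add lookup_scaleR)

lemma linear_coeff_at: "linear (\<lambda>x. coeff_at x p)"
  by (rule linearI) (simp_all add: lookup_add lookup_scaleR)

lemma path_sum_eq_pairing: "path_sum x d = pairing (indicator (set d)) x"
  by (simp add: path_sum_def pairing_indicator)

lemma pairing_chi: "finite A \<Longrightarrow> pairing w (chi A) = (\<Sum>p\<in>A. w p)"
  by (simp add: chi_def pairing_sum pairing_single)

lemma path_sum_chi:
  assumes "successively dyck_step d" "antichain A" "finite A"
  shows "path_sum (chi A) d = of_bool (set d \<inter> A \<noteq> {})"
proof -
  have "path_sum (chi A) d = real (card (set d \<inter> A))"
    using assms(3)
    by (simp add: path_sum_eq_pairing pairing_chi indicator_def sum_of_bool_eq Int_commute)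
  then show ?thesis
    using card_pair_chain_Int_antichain[OF dyck_steps_chain[OF assms(1)] assms(2)] by simp
qed

definition FFLV_A_constraints :: "nat \<Rightarrow> weight \<Rightarrow> ((point \<Rightarrow> real) \<times> real) set" where
  "FFLV_A_constraints m b =
     (\<lambda>d. (\<lambda>x. path_sum x d, real (boundA b d))) ` {d. dyck_pathA m d} \<union>
     (\<lambda>p. (\<lambda>x. - coeff_at x p, 0)) ` pairsA m"

lemma solutions_FFLV_A_constraints:
  "solutions (coord_space (pairsA m)) (FFLV_A_constraints m b) = FFLV_A m b"
  unfolding solutions_def FFLV_A_def FFLV_A_constraints_def ball_Un ball_simps by auto

interpretation FFLV_A: linear_constraints "coord_space (pairsA m)" "FFLV_A_constraints m b"
  rewrites "solutions (coord_space (pairsA m)) (FFLV_A_constraints m b) = FFLV_A m b"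
proof -
  show "linear_constraints (coord_space (pairsA m)) (FFLV_A_constraints m b)"
  proof (rule linear_constraints.intro)
    show "finite (FFLV_A_constraints m b)"
      using finite_pairsA finite_subset[OF _ finite_dyck_steps[of m], of "{d. dyck_pathA m d}"]
      by (auto simp: FFLV_A_constraints_def dyck_pathA_def)
    show "linear l" if "(l, c) \<in> FFLV_A_constraints m b" for l c
      using that linear_pairing linear_compose_neg[OF linear_coeff_at]
      by (auto simp: FFLV_A_constraints_def path_sum_eq_pairing)
  qed (rule subspace_coord_space)
qed (rule solutions_FFLV_A_constraints)

lemma FFLV_A_coeff_nonneg: "x \<in> FFLV_A m b \<Longrightarrow> 0 \<le> coeff_at x p"
  using coeff_at_eq_0[of x "pairsA m" p] by (cases "p \<in> pairsA m") (auto simp: FFLV_A_def)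

lemma FFLV_A_exposing_weight:
  assumes "x extreme_point_of FFLV_A m b"
  obtains w where "\<And>z. z \<in> FFLV_A m b \<Longrightarrow> z \<noteq> x \<Longrightarrow> pairing w z < pairing w x"
proof -
  obtain l :: "point \<Rightarrow> real" where "linear l" "\<And>z. z \<in> FFLV_A m b \<Longrightarrow> z \<noteq> x \<Longrightarrow> l z < l x"
    using FFLV_A.extreme_point_exposed[OF assms] by blast
  then show thesis using that linear_functional_eq_pairing by metis
qed

lemma coord_space_face_of:
  assumes "convex P" and nonneg: "\<And>x p. x \<in> P \<Longrightarrow> 0 \<le> coeff_at x p"
  shows "(P \<inter> coord_space I) face_of P"
proof -
  have "y \<in> coord_space I \<and> z \<in> coord_space I"
    if yz: "y \<in> P" "z \<in> P" and x: "x \<in> coord_space I" "x \<in> open_segment y z" for x y z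
  proof -
    obtain u where u: "0 < u" "u < 1" "x = (1 - u) *\<^sub>R y + u *\<^sub>R z"
      using x(2) by (auto simp: in_segment)
    have "- coeff_at y p = 0 \<and> - coeff_at z p = 0" if "p \<notin> I" for p
    proof -
      have "(1 - u) * (- coeff_at y p) + u * (- coeff_at z p) = - coeff_at x p"
        by (simp add: u(3) lookup_add lookup_scaleR)
      then show ?thesis
        using coeff_at_eq_0[OF x(1) that] nonneg yz u(1,2)
          convex_combination_eq_bound[of "- coeff_at y p" 0 "- coeff_at z p" u] by simp
    qed
    then show ?thesis by (auto intro!: coord_spaceI)
  qed
  moreover have "convex (P \<inter> coord_space I)"
    using assms(1) subspace_imp_convex[OF subspace_coord_space] by (rule convex_Int)
  ultimately show ?thesis unfolding face_of_def by blast
qed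

lemma path_sum_sum_chi:
  assumes "successively dyck_step d" "\<And>i. i \<in> I \<Longrightarrow> antichain (A i) \<and> finite (A i)"
  shows "path_sum (\<Sum>i\<in>I. c i *\<^sub>R chi (A i)) d = (\<Sum>i\<in>I. c i * of_bool (set d \<inter> A i \<noteq> {}))"
  using assms
  by (simp add: path_sum_eq_pairing pairing_sum pairing_scaleR flip: path_sum_chi)

lemma coeff_at_sum_chi:
  assumes "\<And>i. i \<in> I \<Longrightarrow> finite (A i)"
  shows "coeff_at (\<Sum>i\<in>I. c i *\<^sub>R chi (A i)) p = (\<Sum>i\<in>I. c i * indicator (A i) p)"
  using assms by (simp add: lookup_sum lookup_scaleR lookup_chi)

lemma sum_chi_in_FFLV_A:
  assumes "finite I" and A: "\<And>i. i \<in> I \<Longrightarrow> A i \<subseteq> Q m i" "\<And>i. i \<in> I \<Longrightarrow> antichain (A i)"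
  shows "(\<Sum>i\<in>I. real (b i) *\<^sub>R chi (A i)) \<in> FFLV_A m b"
proof -
  let ?x = "\<Sum>i\<in>I. real (b i) *\<^sub>R chi (A i)"
  have fin: "finite (A i)" if "i \<in> I" for i
    using A(1)[OF that] finite_Q finite_subset by blast
  have coeff: "coeff_at ?x p = (\<Sum>i\<in>I. real (b i) * indicator (A i) p)" for p
    using fin by (rule coeff_at_sum_chi)
  have "?x \<in> coord_space (pairsA m)"
  proof (rule coord_spaceI)
    fix p assume "p \<notin> pairsA m"
    then have "p \<notin> A i" if "i \<in> I" for i using A(1)[OF that] Q_subset_pairsA by blast
    then show "coeff_at ?x p = 0" by (simp add: coeff)
  qed
  moreover have "0 \<le> coeff_at ?x p" for p
    unfolding coeff by (intro sum_nonneg) auto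
  moreover have "path_sum ?x d \<le> real (boundA b d)" if d: "dyck_pathA m d" for d
  proof -
    let ?J = "{fst (hd d)..fst (last d)}"
    have "path_sum ?x d = (\<Sum>i\<in>I. real (b i) * of_bool (set d \<inter> A i \<noteq> {}))"
      using d A(2) fin by (intro path_sum_sum_chi) (auto simp: dyck_pathA_def)
    also have "\<dots> \<le> (\<Sum>i\<in>I. real (b i) * of_bool (i \<in> ?J))"
      using dyck_pathA_meets_Q[OF d] A(1) by (intro sum_mono mult_left_mono) fastforce+
    also have "\<dots> = (\<Sum>i\<in>I \<inter> ?J. real (b i))"
      using \<open>finite I\<close> by (simp add: of_bool_def if_distrib sum.inter_restrict cong: if_cong)
    also have "\<dots> \<le> real (boundA b d)"
      unfolding boundA_def of_nat_sum by (intro sum_mono2) auto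
    finally show ?thesis .
  qed
  ultimately show ?thesis by (simp add: FFLV_A_def)
qed

section \<open>Level sets of the potential of a point\<close>

lemma has_bochner_integral_indicator_Ioc:
  assumes "u \<le> v"
  shows "has_bochner_integral lborel (\<lambda>t. c * indicator {u<..v} t) (c * (v - u :: real))"
  using has_bochner_integral_real_indicator[of "{u<..v}" lborel] assms
  by (intro has_bochner_integral_mult_right) auto

definition initial_paths :: "nat \<Rightarrow> nat \<times> nat \<Rightarrow> (nat \<times> nat) list set" where
  "initial_paths m p = {d. \<exists>r. lattice_path m (r, r + 1) p d}"

lemma finite_initial_paths: "finite (initial_paths m p)"
  by (rule finite_subset[OF _ finite_dyck_steps[of m]])
    (auto simp: initial_paths_def lattice_path_def)

lemma initial_path_exists:
  assumes "p \<in> pairsA m"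
  obtains d where "lattice_path m (fst p, fst p + 1) p d"
  using assms lattice_path_exists[of "(fst p, fst p + 1)" m p]
  by (force simp: pairsA_def pair_le_def)

locale FFLV_A_point =
  fixes m :: nat and b :: weight and x :: point
  assumes in_FFLV_A: "x \<in> FFLV_A m b"
begin

text \<open>
  The transfer map from marked chain polytopes to marked order polytopes: the potential takes the
  value \<open>mark k\<close> at the position \<open>(k, k)\<close> and drops by at least \<open>x\<^sub>p\<close> at the pair \<open>p\<close>.
\<close>

definition mark :: "nat \<Rightarrow> real" where
  "mark k = (\<Sum>l=k..<m. real (b l))"

definition potential :: "nat \<times> nat \<Rightarrow> real" where
  "potential p = (MIN d\<in>initial_paths m p. mark (fst (hd d)) - path_sum x d)"

lemma coeff_nonneg: "0 \<le> coeff_at x p"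
  using in_FFLV_A by (rule FFLV_A_coeff_nonneg)

lemma path_sum_mono: "set d \<subseteq> set e \<Longrightarrow> path_sum x d \<le> path_sum x e"
  unfolding path_sum_def by (rule sum_mono2) (auto simp: coeff_nonneg)

lemma coeff_le_path_sum: "p \<in> set d \<Longrightarrow> coeff_at x p \<le> path_sum x d"
  unfolding path_sum_def by (rule member_le_sum) (auto simp: coeff_nonneg)

lemma mark_antimono: "k \<le> l \<Longrightarrow> mark l \<le> mark k"
  unfolding mark_def by (rule sum_mono2) auto

lemma mark_diff: "k \<le> l \<Longrightarrow> l \<le> m \<Longrightarrow> mark k - mark l = (\<Sum>i=k..<l. real (b i))"
  using sum.atLeastLessThan_concat[of k l m "\<lambda>i. real (b i)"] by (simp add: mark_def)

lemma potential_le: "lattice_path m (r, r + 1) p d \<Longrightarrow> potential p \<le> mark r - path_sum x d"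
  unfolding potential_def using finite_initial_paths
  by (intro Min_le image_eqI[of _ _ d]) (auto simp: initial_paths_def lattice_path_def)

lemma potential_attained:
  assumes "p \<in> pairsA m"
  obtains r d where "lattice_path m (r, r + 1) p d" "potential p = mark r - path_sum x d"
proof -
  let ?f = "\<lambda>d. mark (fst (hd d)) - path_sum x d"
  have "initial_paths m p \<noteq> {}"
    using initial_path_exists[OF assms] by (force simp: initial_paths_def)
  then have "potential p \<in> ?f ` initial_paths m p"
    unfolding potential_def using finite_initial_paths by (intro Min_in) auto
  then show thesis using that by (auto simp: initial_paths_def lattice_path_def)
qed

lemma potential_drop:
  assumes "q \<in> pairsA m" "p \<in> pairsA m" "q \<preceq> p" "q \<noteq> p"
  shows "potential p + coeff_at x p \<le> potential q"
proof -
  obtain r d where d: "lattice_path m (r, r + 1) q d" "potential q = mark r - path_sum x d"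
    using potential_attained[OF assms(1)] .
  obtain e where e: "lattice_path m q p e" using lattice_path_exists assms(1-3) .
  obtain c where c: "lattice_path m (r, r + 1) p c" "set c = set d \<union> set e"
    using lattice_path_append[OF d(1) e] .
  have "p \<notin> set d" using lattice_path_between(2)[OF d(1)] assms(3,4) pair_le_antisym by blast
  then have "path_sum x d + coeff_at x p = (\<Sum>q\<in>insert p (set d). coeff_at x q)"
    by (simp add: path_sum_def)
  also have "\<dots> \<le> path_sum x c"
    unfolding path_sum_def using c(2) lattice_path_endpoints(2)[OF e]
    by (intro sum_mono2) (auto simp: coeff_nonneg)
  finally show ?thesis using potential_le[OF c(1)] d(2) by simp
qed

lemma potential_le_mark:
  assumes "p \<in> pairsA m"
  shows "potential p + coeff_at x p \<le> mark (fst p)"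
proof -
  obtain d where d: "lattice_path m (fst p, fst p + 1) p d"
    using initial_path_exists[OF assms] .
  then show ?thesis
    using potential_le[OF d] coeff_le_path_sum[OF lattice_path_endpoints(2)[OF d]] by simp
qed

lemma mark_le_potential:
  assumes p: "p \<in> pairsA m"
  shows "mark (snd p) \<le> potential p"
proof -
  obtain s where s: "snd p = s + 1" using p by (cases "snd p") (auto simp: pairsA_def)
  obtain r d where d: "lattice_path m (r, r + 1) p d" "potential p = mark r - path_sum x d"
    using potential_attained[OF p] .
  obtain e where e: "lattice_path m p (s, s + 1) e"
    using lattice_path_exists[of p m "(s, s + 1)"] p s by (force simp: pairsA_def pair_le_def)
  obtain c where c: "lattice_path m (r, r + 1) (s, s + 1) c" "set c = set d \<union> set e"
    using lattice_path_append[OF d(1) e] .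
  have rs: "r \<le> s" "s < m"
    using lattice_path_between(2)[OF c(1)] lattice_path_endpoints(1,4)[OF c(1)]
    by (auto simp: pair_le_def pairsA_def)
  have "path_sum x d \<le> path_sum x c" using c(2) by (intro path_sum_mono) simp
  also have "\<dots> \<le> real (boundA b c)"
    using in_FFLV_A lattice_path_dyck_pathA[OF c(1)] by (simp add: FFLV_A_def)
  also have "\<dots> = mark r - mark (s + 1)"
    using c(1) rs
    by (simp add: boundA_def lattice_path_def mark_diff atLeastLessThanSuc_atLeastAtMost)
  finally show ?thesis using d(2) s by simp
qed

definition level_set :: "real \<Rightarrow> (nat \<times> nat) set" where
  "level_set t = {p \<in> pairsA m. potential p < t \<and> t \<le> potential p + coeff_at x p}"

lemma antichain_level_set: "antichain (level_set t)"
  using potential_drop by (fastforce simp: antichain_def level_set_def)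

lemma level_set_subset_Q:
  assumes "mark (k + 1) < t" "t \<le> mark k"
  shows "level_set t \<subseteq> Q m k"
proof
  fix p assume "p \<in> level_set t"
  then have p: "p \<in> pairsA m" "mark (snd p) < t" "t \<le> mark (fst p)"
    using mark_le_potential[of p] potential_le_mark[of p] by (auto simp: level_set_def)
  have "fst p \<le> k"
    using mark_antimono[of "k + 1" "fst p"] p(3) assms(1) by (cases "fst p \<le> k") auto
  moreover have "k < snd p"
    using mark_antimono[of "snd p" k] p(2) assms(2) by (cases "k < snd p") auto
  ultimately show "p \<in> Q m k" using p(1) by (auto simp: pairsA_def Q_def)
qed

lemma level_set_nonempty:
  assumes "p \<in> level_set t"
  obtains k where "k \<in> {1..<m}" "mark (k + 1) < t" "t \<le> mark k"
proof -
  have p: "1 \<le> fst p" "fst p < snd p" "snd p \<le> m" "mark (snd p) < t" "t \<le> mark (fst p)"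
    using assms mark_le_potential[of p] potential_le_mark[of p]
    by (auto simp: level_set_def pairsA_def)
  have "\<exists>k\<in>{fst p..<snd p}. mark (k + 1) < t \<and> t \<le> mark k"
  proof (rule ccontr)
    assume none: "\<not> ?thesis"
    have "l \<le> snd p \<Longrightarrow> t \<le> mark l" if "fst p \<le> l" for l
      using that
    proof (induction l rule: dec_induct)
      case (step l)
      then show ?case using none by force
    qed (use p(5) in simp)
    from this[of "snd p"] show False using p by simp
  qed
  then obtain k where "k \<in> {fst p..<snd p}" "mark (k + 1) < t" "t \<le> mark k" by blast
  then show thesis using that[of k] p(1,3) by simp
qed

lemma mark_interval_unique:
  assumes "mark (k + 1) < t" "t \<le> mark k" "mark (l + 1) < t" "t \<le> mark l"
  shows "k = l"
  using assms mark_antimono[of "k + 1" l] mark_antimono[of "l + 1" k]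
  by (cases k l rule: linorder_cases) auto

lemma has_bochner_integral_level_sets:
  "has_bochner_integral lborel (\<lambda>t. \<Sum>p\<in>level_set t. w p) (pairing w x)"
proof -
  let ?I = "\<lambda>p. {potential p<..potential p + coeff_at x p}"
  have "has_bochner_integral lborel (\<lambda>t. \<Sum>p\<in>pairsA m. w p * indicator (?I p) t)
      (\<Sum>p\<in>pairsA m. w p * coeff_at x p)"
  proof (rule has_bochner_integral_sum)
    show "has_bochner_integral lborel (\<lambda>t. w p * indicator (?I p) t) (w p * coeff_at x p)" for p
      using has_bochner_integral_indicator_Ioc[of "potential p" "potential p + coeff_at x p" "w p"]
        coeff_nonneg[of p] by simp
  qed
  moreover have "(\<Sum>p\<in>level_set t. w p) = (\<Sum>p\<in>pairsA m. w p * indicator (?I p) t)" for t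
    using finite_pairsA
    by (intro sum.mono_neutral_cong_left) (auto simp: level_set_def indicator_def)
  moreover have "pairing w x = (\<Sum>p\<in>pairsA m. w p * coeff_at x p)"
    using in_FFLV_A finite_pairsA by (intro pairing_eq_sum) (auto simp: FFLV_A_def coord_space_def)
  ultimately show ?thesis by simp
qed

lemma sum_level_set_le:
  fixes w :: "nat \<times> nat \<Rightarrow> real"
  assumes w: "\<And>k A. k \<in> {1..<m} \<Longrightarrow> 0 < b k \<Longrightarrow> A \<subseteq> Q m k \<Longrightarrow> antichain A \<Longrightarrow>
      (\<Sum>p\<in>A. w p) \<le> M k"
  shows "(\<Sum>p\<in>level_set t. w p) \<le> (\<Sum>k=1..<m. M k * indicator {mark (k + 1)<..mark k} t)"
proof (cases "\<exists>k\<in>{1..<m}. mark (k + 1) < t \<and> t \<le> mark k")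
  case True
  then obtain k where k: "k \<in> {1..<m}" "mark (k + 1) < t" "t \<le> mark k" by auto
  have disjoint: "t \<notin> {mark (l + 1)<..mark l}" if "l \<noteq> k" for l
    using mark_interval_unique[OF k(2,3), of l] that by auto
  have "0 < b k" using k mark_diff[of k "k + 1"] by (cases "b k = 0") auto
  then have "(\<Sum>p\<in>level_set t. w p) \<le> M k"
    using k level_set_subset_Q antichain_level_set by (intro w) auto
  also have "M k = (\<Sum>l\<in>{k}. M l * indicator {mark (l + 1)<..mark l} t)"
    using k by (simp add: indicator_def)
  also have "\<dots> = (\<Sum>l=1..<m. M l * indicator {mark (l + 1)<..mark l} t)"
    using k(1) disjoint by (intro sum.mono_neutral_left) auto
  finally show ?thesis .
next
  case False
  then have "level_set t = {}" by (metis equals0I level_set_nonempty)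
  moreover have "(\<Sum>k=1..<m. M k * indicator {mark (k + 1)<..mark k} t) = 0"
    using False by (intro sum.neutral) (auto simp: indicator_def)
  ultimately show ?thesis by simp
qed

text \<open>The Minkowski sum property of FFLV polytopes, in terms of support functions.\<close>

lemma pairing_le_sum_antichain_bounds:
  assumes w: "\<And>k A. k \<in> {1..<m} \<Longrightarrow> 0 < b k \<Longrightarrow> A \<subseteq> Q m k \<Longrightarrow> antichain A \<Longrightarrow>
      (\<Sum>p\<in>A. w p) \<le> M k"
  shows "pairing w x \<le> (\<Sum>k=1..<m. real (b k) * M k)"
proof -
  let ?G = "\<lambda>t. \<Sum>k=1..<m. M k * indicator {mark (k + 1)<..mark k} t"
  have "has_bochner_integral lborel
      (\<lambda>t. M k * indicator {mark (k + 1)<..mark k} t) (real (b k) * M k)" if "k \<in> {1..<m}" for k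
    using has_bochner_integral_indicator_Ioc[of "mark (k + 1)" "mark k" "M k"]
      mark_antimono[of k "k + 1"] mark_diff[of k "k + 1"] that by (simp add: mult.commute)
  then have G: "has_bochner_integral lborel ?G (\<Sum>k=1..<m. real (b k) * M k)"
    by (rule has_bochner_integral_sum)
  have "integral\<^sup>L lborel (\<lambda>t. \<Sum>p\<in>level_set t. w p) \<le> integral\<^sup>L lborel ?G"
    using has_bochner_integral_level_sets[of w] G sum_level_set_le[OF w]
    by (intro integral_mono) (simp_all add: has_bochner_integral_iff)
  then show ?thesis
    using has_bochner_integral_level_sets[of w] G by (simp only: has_bochner_integral_iff)
qed

end

section \<open>Vertices of the type A polytope are sums of antichains\<close>

lemma pairing_sum_chi:
  assumes "\<And>i. i \<in> I \<Longrightarrow> c i \<noteq> 0 \<Longrightarrow> finite (A i)"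
  shows "pairing w (\<Sum>i\<in>I. c i *\<^sub>R chi (A i)) = (\<Sum>i\<in>I. c i * (\<Sum>p\<in>A i. w p))"
proof -
  have "c i * pairing w (chi (A i)) = c i * (\<Sum>p\<in>A i. w p)" if "i \<in> I" for i
    using assms[OF that] by (cases "c i = 0") (simp_all add: pairing_chi)
  then have "(\<Sum>i\<in>I. c i * pairing w (chi (A i))) = (\<Sum>i\<in>I. c i * (\<Sum>p\<in>A i. w p))"
    by (rule sum.cong[OF refl])
  then show ?thesis by (simp only: pairing_sum pairing_scaleR real_scaleR_def)
qed

lemma chi_eq_iff: "finite A \<Longrightarrow> finite B \<Longrightarrow> chi A = chi B \<longleftrightarrow> A = B"
  by (metis indicator_eq_1_iff lookup_chi subsetI subset_antisym)

definition unique_max_antichain :: "nat \<Rightarrow> nat \<Rightarrow> (nat \<times> nat \<Rightarrow> real) \<Rightarrow> (nat \<times> nat) set \<Rightarrow> bool" where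
  "unique_max_antichain m k w A \<longleftrightarrow> A \<subseteq> Q m k \<and> antichain A \<and>
     (\<forall>X. X \<subseteq> Q m k \<longrightarrow> antichain X \<longrightarrow> X \<noteq> A \<longrightarrow> (\<Sum>p\<in>X. w p) < (\<Sum>p\<in>A. w p))"

lemma finite_unique_max_antichain: "unique_max_antichain m k w A \<Longrightarrow> finite A"
  unfolding unique_max_antichain_def using finite_subset[OF _ finite_Q] by blast

lemma unique_max_antichain_exists:
  assumes "inj_on (sum w) (Pow (Q m k))"
  obtains A where "unique_max_antichain m k w A"
proof -
  let ?\<A> = "{X. X \<subseteq> Q m k \<and> antichain X}"
  have "finite ?\<A>" "{} \<in> ?\<A>" using finite_Q by (auto simp: antichain_def)
  then obtain A where A: "A \<in> ?\<A>" "\<And>X. X \<in> ?\<A> \<Longrightarrow> (\<Sum>p\<in>X. w p) \<le> (\<Sum>p\<in>A. w p)"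
    using obtains_MAX[of ?\<A> "sum w"]
    by (metis (no_types, lifting) Max_ge empty_iff finite_imageI imageI)
  have "unique_max_antichain m k w A"
    unfolding unique_max_antichain_def
    using A inj_onD[OF assms, of _ A] by (auto simp: order.strict_iff_order)
  then show thesis by (rule that)
qed

lemma unique_max_antichain_weight_nonneg:
  assumes A: "unique_max_antichain m k w A" and "p \<in> A"
  shows "0 \<le> w p"
proof -
  have "A - {p} \<subseteq> Q m k" "antichain (A - {p})"
    using A by (auto simp: unique_max_antichain_def antichain_def)
  moreover have "A - {p} \<noteq> A" using \<open>p \<in> A\<close> by blast
  ultimately have "(\<Sum>q\<in>A - {p}. w q) < (\<Sum>q\<in>A. w q)"
    using A by (simp add: unique_max_antichain_def)
  then show ?thesis using finite_unique_max_antichain[OF A] \<open>p \<in> A\<close> by (simp add: sum_diff1)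
qed

lemma eventually_perturbed_antichain_max:
  assumes "unique_max_antichain m k w A"
  shows "\<forall>\<^sub>F e in at_right 0. \<forall>X. X \<subseteq> Q m k \<longrightarrow> antichain X \<longrightarrow>
    (\<Sum>p\<in>X. w p + e * u p) \<le> (\<Sum>p\<in>A. w p + e * u p)"
proof -
  have "\<forall>\<^sub>F e in at_right 0. (\<Sum>p\<in>X. w p + e * u p) \<le> (\<Sum>p\<in>A. w p + e * u p)"
    if "X \<in> {X. X \<subseteq> Q m k \<and> antichain X}" for X
  proof (cases "X = A")
    case False
    then have "0 < (\<Sum>p\<in>A. w p) - (\<Sum>p\<in>X. w p)"
      using that assms by (simp add: unique_max_antichain_def)
    then have "\<forall>\<^sub>F e in at_right 0.
        0 < (\<Sum>p\<in>A. w p) - (\<Sum>p\<in>X. w p) + e * ((\<Sum>p\<in>A. u p) - (\<Sum>p\<in>X. u p))"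
      by (rule eventually_at_right_affine_pos)
    then show ?thesis
      by (rule eventually_mono) (simp add: sum.distrib sum_distrib_left[symmetric] algebra_simps)
  qed simp
  then have "\<forall>\<^sub>F e in at_right 0. \<forall>X\<in>{X. X \<subseteq> Q m k \<and> antichain X}.
      (\<Sum>p\<in>X. w p + e * u p) \<le> (\<Sum>p\<in>A. w p + e * u p)"
    using finite_Q by (intro eventually_ball_finite) auto
  then show ?thesis by (rule eventually_mono) blast
qed

text \<open>
  The bound on functionals is only weak; that it is strict away from the maximizer follows by
  applying it to all small perturbations of \<open>w\<close>.
\<close>

lemma FFLV_A_unique_maximizer:
  assumes A: "\<And>k. k \<in> {1..<m} \<Longrightarrow> 0 < b k \<Longrightarrow> unique_max_antichain m k w (A k)"
    and z: "z \<in> FFLV_A m b" "z \<noteq> (\<Sum>k=1..<m. real (b k) *\<^sub>R chi (A k))"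
  shows "pairing w z < pairing w (\<Sum>k=1..<m. real (b k) *\<^sub>R chi (A k))"
proof (rule ccontr)
  let ?y = "\<Sum>k=1..<m. real (b k) *\<^sub>R chi (A k)"
  assume "\<not> ?thesis"
  then have le: "pairing w ?y \<le> pairing w z" by simp
  have pairing_y: "pairing u ?y = (\<Sum>k=1..<m. real (b k) * (\<Sum>p\<in>A k. u p))" for u
    using A by (intro pairing_sum_chi) (auto intro: finite_unique_max_antichain)
  interpret FFLV_A_point m b z by unfold_locales (rule z(1))
  have dominated: "pairing u z \<le> pairing u ?y" for u
  proof -
    have "\<forall>\<^sub>F e in at_right 0. \<forall>k\<in>{k\<in>{1..<m}. 0 < b k}. \<forall>X. X \<subseteq> Q m k \<longrightarrow> antichain X \<longrightarrow>
        (\<Sum>p\<in>X. w p + e * u p) \<le> (\<Sum>p\<in>A k. w p + e * u p)"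
      using A by (intro eventually_ball_finite ballI eventually_perturbed_antichain_max) auto
    then obtain e where "0 < e" and e: "\<forall>k\<in>{k\<in>{1..<m}. 0 < b k}. \<forall>X. X \<subseteq> Q m k \<longrightarrow> antichain X \<longrightarrow>
        (\<Sum>p\<in>X. w p + e * u p) \<le> (\<Sum>p\<in>A k. w p + e * u p)"
      by (rule eventually_at_right_obtain)
    have "pairing (\<lambda>p. w p + e * u p) z \<le> pairing (\<lambda>p. w p + e * u p) ?y"
      unfolding pairing_y by (rule pairing_le_sum_antichain_bounds) (use e in auto)
    then have "e * pairing u z \<le> e * pairing u ?y" using le by (simp add: pairing_perturb)
    then show ?thesis using \<open>0 < e\<close> by simp
  qed
  have "coeff_at z p = coeff_at ?y p" for p
    using dominated[of "indicator {p}"] dominated[of "\<lambda>q. - indicator {p} q"]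
    by (simp add: pairing_minus_weight pairing_indicator)
  then show False using z(2) by (auto intro: poly_mapping_eqI)
qed

abbreviation omega_pair :: "nat \<Rightarrow> weight" where
  "omega_pair i \<equiv> \<lambda>k. omegaA i k + omegaA (i + 1) k"

lemma chi_add_in_FFLV_A:
  assumes "A \<subseteq> Q m i" "antichain A" "B \<subseteq> Q m (i + 1)" "antichain B"
  shows "chi A + chi B \<in> FFLV_A m (omega_pair i)"
proof -
  let ?C = "\<lambda>k. if k = i then A else B"
  have "(\<Sum>k\<in>{i, i + 1}. real (omega_pair i k) *\<^sub>R chi (?C k)) \<in> FFLV_A m (omega_pair i)"
    by (rule sum_chi_in_FFLV_A) (use assms in \<open>auto simp: omegaA_def\<close>)
  then show ?thesis by (simp add: omegaA_def)
qed

lemma chi_add_extreme_if_unique_max_antichains: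
  assumes i: "1 \<le> i" "i + 1 < m"
    and A: "unique_max_antichain m i w A" and B: "unique_max_antichain m (i + 1) w B"
  shows "(chi A + chi B) extreme_point_of FFLV_A m (omega_pair i)"
proof (rule extreme_point_of_unique_maximizer[OF linear_pairing[of w]])
  show "chi A + chi B \<in> FFLV_A m (omega_pair i)"
    using A B by (intro chi_add_in_FFLV_A) (auto simp: unique_max_antichain_def)
  let ?C = "\<lambda>k. if k = i then A else B"
  have "(\<Sum>k=1..<m. real (omega_pair i k) *\<^sub>R chi (?C k))
      = (\<Sum>k\<in>{i, i + 1}. real (omega_pair i k) *\<^sub>R chi (?C k))"
    using i by (intro sum.mono_neutral_right) (auto simp: omegaA_def)
  then have sum: "(\<Sum>k=1..<m. real (omega_pair i k) *\<^sub>R chi (?C k)) = chi A + chi B"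
    by (simp add: omegaA_def)
  fix z assume z: "z \<in> FFLV_A m (omega_pair i)" "z \<noteq> chi A + chi B"
  have "unique_max_antichain m k w (?C k)" if "0 < omega_pair i k" for k
    using that A B by (auto simp: omegaA_def split: if_splits)
  then show "pairing w z < pairing w (chi A + chi B)"
    using FFLV_A_unique_maximizer[of m "omega_pair i" w ?C z] z unfolding sum by simp
qed

lemma exists_generic_weight:
  fixes w0 :: "nat \<times> nat \<Rightarrow> real"
  assumes "finite I" "finite D" "\<And>y. y \<in> D \<Longrightarrow> 0 < pairing w0 y"
  obtains w where "\<And>y. y \<in> D \<Longrightarrow> 0 < pairing w y" "inj_on (sum w) (Pow I)"
proof -
  define E where "E = (\<lambda>(X, Y). chi X - chi Y) ` {(X, Y) \<in> Pow I \<times> Pow I. X \<noteq> Y}"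
  have fin: "finite X" if "X \<in> Pow I" for X using that assms(1) finite_subset by blast
  have "finite {(X, Y) \<in> Pow I \<times> Pow I. X \<noteq> Y}"
    by (rule finite_subset[of _ "Pow I \<times> Pow I"]) (use assms(1) in auto)
  then have "finite E" unfolding E_def by (rule finite_imageI)
  moreover have "0 \<notin> E" using fin by (auto simp: E_def chi_eq_iff)
  ultimately obtain w where w: "\<And>y. y \<in> D \<Longrightarrow> 0 < pairing w y" "\<And>y. y \<in> E \<Longrightarrow> pairing w y \<noteq> 0"
    using exists_generic_functional[of E D w0] assms(2,3) by blast
  have "X = Y" if "X \<in> Pow I" "Y \<in> Pow I" "(\<Sum>p\<in>X. w p) = (\<Sum>p\<in>Y. w p)" for X Y
  proof (rule ccontr)
    assume "X \<noteq> Y"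
    then have "chi X - chi Y \<in> E" using that by (auto simp: E_def)
    moreover have "pairing w (chi X - chi Y) = 0"
      using that fin by (simp add: pairing_diff pairing_chi)
    ultimately show False using w(2) by blast
  qed
  then show thesis using that w(1) by (metis inj_onI)
qed

definition antichain_sums :: "nat \<Rightarrow> weight \<Rightarrow> (nat \<times> nat) set \<Rightarrow> point set" where
  "antichain_sums m b S = (\<lambda>A. \<Sum>k=1..<m. real (b k) *\<^sub>R chi (A k)) `
     (\<Pi>\<^sub>E k\<in>{1..<m}. {X. X \<subseteq> Q m k \<inter> S \<and> antichain X})"

lemma finite_antichain_sums: "finite (antichain_sums m b S)"
  unfolding antichain_sums_def using finite_Q
  by (intro finite_imageI finite_PiE) (auto intro: rev_finite_subset[of "Pow (Q m _)"])

lemma antichain_sumsI: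
  assumes "\<And>k. k \<in> {1..<m} \<Longrightarrow> A k \<subseteq> Q m k \<inter> S \<and> antichain (A k)"
  shows "(\<Sum>k=1..<m. real (b k) *\<^sub>R chi (A k)) \<in> antichain_sums m b S"
  unfolding antichain_sums_def using assms
  by (intro image_eqI[of _ _ "restrict A {1..<m}"]) auto

lemma antichain_sums_subset: "antichain_sums m b S \<subseteq> FFLV_A m b \<inter> coord_space S"
proof -
  have "(\<Sum>k=1..<m. real (b k) *\<^sub>R chi (A k)) \<in> FFLV_A m b \<inter> coord_space S"
    if A: "A \<in> (\<Pi>\<^sub>E k\<in>{1..<m}. {X. X \<subseteq> Q m k \<inter> S \<and> antichain X})" for A
  proof
    have A': "A k \<subseteq> Q m k" "A k \<subseteq> S" "antichain (A k)" if "k \<in> {1..<m}" for k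
      using PiE_mem[OF A that] by auto
    then show "(\<Sum>k=1..<m. real (b k) *\<^sub>R chi (A k)) \<in> FFLV_A m b"
      by (intro sum_chi_in_FFLV_A) auto
    have "coeff_at (chi (A k)) p = 0" if "k \<in> {1..<m}" "p \<notin> S" for k p
    proof -
      have "finite (A k)" using A'(1)[OF that(1)] finite_Q by (rule finite_subset)
      moreover have "p \<notin> A k" using A'(2)[OF that(1)] that(2) by blast
      ultimately show ?thesis by (simp add: lookup_chi)
    qed
    then show "(\<Sum>k=1..<m. real (b k) *\<^sub>R chi (A k)) \<in> coord_space S"
      by (intro coord_spaceI) (simp add: lookup_sum lookup_scaleR)
  qed
  then show ?thesis by (auto simp: antichain_sums_def)
qed

text \<open>
  Negative weights outside \<open>S\<close> do not affect the pairing with \<open>x\<close>, but keep the maximizing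
  antichains inside \<open>S\<close>.
\<close>

lemma exists_generic_exposing_weight:
  assumes "x extreme_point_of FFLV_A m b" "x \<in> coord_space S"
  obtains w where "inj_on (sum w) (Pow (pairsA m))"
    and "\<And>p. p \<in> pairsA m - S \<Longrightarrow> w p < 0"
    and "\<And>z. z \<in> antichain_sums m b S \<Longrightarrow> z \<noteq> x \<Longrightarrow> pairing w z < pairing w x"
proof -
  obtain w0 where w0: "\<And>z. z \<in> FFLV_A m b \<Longrightarrow> z \<noteq> x \<Longrightarrow> pairing w0 z < pairing w0 x"
    using FFLV_A_exposing_weight[OF assms(1)] by blast
  define w1 where "w1 p = (if p \<in> S then w0 p else - 1)" for p
  have w1: "pairing w1 z = pairing w0 z" if "z \<in> coord_space S" for z
    using that by (intro pairing_cong) (auto simp: w1_def coord_space_def)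
  define D where "D = (\<lambda>z. x - z) ` (antichain_sums m b S - {x}) \<union>
    (\<lambda>p. Poly_Mapping.single p (- 1)) ` (pairsA m - S)"
  have "finite D" using finite_antichain_sums finite_pairsA by (simp add: D_def)
  moreover have "0 < pairing w1 (x - z)" if "z \<in> antichain_sums m b S - {x}" for z
  proof -
    have "z \<in> FFLV_A m b" "z \<in> coord_space S" using that antichain_sums_subset by blast+
    then show ?thesis using that w0[of z] w1 assms(2) by (simp add: pairing_diff)
  qed
  then have "0 < pairing w1 y" if "y \<in> D" for y
    using that by (auto simp: D_def pairing_single w1_def)
  ultimately obtain w where w: "\<And>y. y \<in> D \<Longrightarrow> 0 < pairing w y"
    "inj_on (sum w) (Pow (pairsA m))"
    using exists_generic_weight[OF finite_pairsA[of m], of D w1] by blast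
  show thesis
  proof (rule that[OF w(2)])
    show "w p < 0" if "p \<in> pairsA m - S" for p
      using w(1)[of "Poly_Mapping.single p (- 1)"] that by (simp add: D_def pairing_single)
    show "pairing w z < pairing w x" if "z \<in> antichain_sums m b S" "z \<noteq> x" for z
      using w(1)[of "x - z"] that by (simp add: D_def pairing_diff)
  qed
qed

lemma FFLV_A_vertex_decomposition:
  assumes "x extreme_point_of FFLV_A m b" "x \<in> coord_space S"
  obtains A where "\<And>i. A i \<subseteq> Q m i \<inter> S \<and> antichain (A i)"
    and "\<And>i. 1 \<le> i \<Longrightarrow> i + 1 < m \<Longrightarrow>
      (chi (A i) + chi (A (i + 1))) extreme_point_of FFLV_A m (omega_pair i)"
    and "x = (\<Sum>i=1..<m. real (b i) *\<^sub>R chi (A i))"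
proof -
  obtain w where inj: "inj_on (sum w) (Pow (pairsA m))"
    and neg: "\<And>p. p \<in> pairsA m - S \<Longrightarrow> w p < 0"
    and exposing: "\<And>z. z \<in> antichain_sums m b S \<Longrightarrow> z \<noteq> x \<Longrightarrow> pairing w z < pairing w x"
    using exists_generic_exposing_weight[OF assms] by blast
  have "\<exists>A. unique_max_antichain m k w A" for k
    using unique_max_antichain_exists inj_on_subset[OF inj Pow_mono[OF Q_subset_pairsA]] by blast
  then obtain A where A: "\<And>k. unique_max_antichain m k w (A k)" by metis
  have sub: "A k \<subseteq> Q m k \<inter> S \<and> antichain (A k)" for k
  proof -
    have "A k \<subseteq> Q m k" "antichain (A k)" using A[of k] by (auto simp: unique_max_antichain_def)
    moreover have "p \<in> S" if "p \<in> A k" for p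
      using unique_max_antichain_weight_nonneg[OF A that] neg[of p] calculation(1)
        Q_subset_pairsA that by fastforce
    ultimately show ?thesis by blast
  qed
  have "x = (\<Sum>i=1..<m. real (b i) *\<^sub>R chi (A i))"
  proof (rule ccontr)
    assume ne: "x \<noteq> (\<Sum>i=1..<m. real (b i) *\<^sub>R chi (A i))"
    have "pairing w x < pairing w (\<Sum>i=1..<m. real (b i) *\<^sub>R chi (A i))"
      using A assms(1) ne by (intro FFLV_A_unique_maximizer) (auto simp: extreme_point_of_def)
    also have "\<dots> < pairing w x" using sub ne by (intro exposing antichain_sumsI) auto
    finally show False .
  qed
  then show thesis
    using that sub chi_add_extreme_if_unique_max_antichains[OF _ _ A A] by blast
qed

section \<open>Vertices of the sum of two consecutive fundamental polytopes\<close>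

lemma chi_exchange:
  assumes "finite A" "finite D" "E \<subseteq> A" "D \<inter> A = {}"
  shows "chi (A - E \<union> D) = chi A - chi E + chi D"
proof -
  have "(A - E) \<inter> D = {}" using assms(4) by blast
  then show ?thesis using assms by (simp add: chi_def sum.union_disjoint sum_diff)
qed

locale antichain_vertex_pair =
  fixes m i :: nat and A B :: "(nat \<times> nat) set"
  assumes A: "A \<subseteq> Q m i" "antichain A" and B: "B \<subseteq> Q m (i + 1)" "antichain B"
    and vertex: "(chi A + chi B) extreme_point_of FFLV_A m (omega_pair i)"
begin

lemma no_exchange:
  assumes D: "D \<subseteq> B - A" "D \<subseteq> Q m i" "antichain (A - E \<union> D)"
    and E: "E \<subseteq> A - B" "E \<subseteq> Q m (i + 1)" "antichain (B - D \<union> E)"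
  shows "D = {}" "E = {}"
proof -
  have fin: "finite A" "finite B" using A B finite_Q finite_subset by blast+
  then have finDE: "finite D" "finite E" using D(1) E(1) finite_subset by blast+
  have "chi (A - E \<union> D) + chi B \<in> FFLV_A m (omega_pair i)"
    "chi A + chi (B - D \<union> E) \<in> FFLV_A m (omega_pair i)"
    using A B D E by (intro chi_add_in_FFLV_A; blast)+
  moreover have "chi (A - E \<union> D) = chi A - chi E + chi D" "chi (B - D \<union> E) = chi B - chi D + chi E"
    using fin finDE D(1) E(1) by (intro chi_exchange; blast)+
  ultimately have "chi D - chi E = 0"
    by (intro extreme_point_of_symmetric_segment[OF vertex]) (simp_all add: algebra_simps)
  then have "D = E" using finDE by (simp add: chi_eq_iff)
  then show "D = {}" "E = {}" using D(1) E(1) by blast+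
qed

lemma exists_below:
  assumes "q \<in> B" "fst q \<noteq> i + 1"
  shows "\<exists>p\<in>A. p \<preceq> q"
proof (rule ccontr)
  assume none: "\<not> ?thesis"
  \<comment> \<open>the parts on which the order between \<open>A\<close> and \<open>B\<close> is reversed\<close>
  define D where "D = {q \<in> B. fst q \<le> i \<and> (\<forall>p\<in>A. \<not> p \<preceq> q)}"
  define E where "E = {p \<in> A. \<exists>q\<in>D. q \<preceq> p}"
  have DB: "D \<subseteq> B - A" and DQ: "D \<subseteq> Q m i" using B(1) by (fastforce simp: D_def Q_def)+
  have EA: "E \<subseteq> A - B" using DB antichainD[OF B(2)] by (fastforce simp: E_def)
  have EQ: "E \<subseteq> Q m (i + 1)"
  proof
    fix p assume "p \<in> E"
    then obtain q where "p \<in> A" "q \<in> B" "q \<preceq> p" using DB by (auto simp: E_def)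
    then show "p \<in> Q m (i + 1)" using A(1) B(1) by (force simp: Q_def pair_le_def)
  qed
  have "antichain (A - E \<union> D)"
    using antichainD[OF A(2)] antichainD[OF B(2)]
    unfolding antichain_def E_def D_def by blast
  moreover have "antichain (B - D \<union> E)"
  proof -
    have "\<not> p \<preceq> r \<and> \<not> r \<preceq> p" if p: "p \<in> E" and r: "r \<in> B - D" for p r
    proof -
      obtain q where q: "q \<in> D" "q \<preceq> p" "p \<in> A" using p by (auto simp: E_def)
      have "\<not> p \<preceq> r"
        using q r DB pair_le_trans antichainD[OF B(2), of q r] by blast
      moreover have "\<not> r \<preceq> p"
      proof
        assume le: "r \<preceq> p"
        then have "fst r \<le> i" using q(3) A(1) by (auto simp: Q_def pair_le_def)
        then obtain p' where "p' \<in> A" "p' \<preceq> r" using r by (auto simp: D_def)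
        then have "r = p" using antichain_between_eq[OF A(2) _ q(3)] le by blast
        then show False using p r EA by blast
      qed
      ultimately show ?thesis by blast
    qed
    then show ?thesis
      using antichainD[OF A(2)] antichainD[OF B(2)] EA unfolding antichain_def by blast
  qed
  ultimately have "D = {}" by (rule no_exchange(1)[OF DB DQ _ EA EQ])
  moreover have "fst q \<le> i" using assms B(1) by (force simp: Q_def)
  then have "q \<in> D" using none assms(1) by (simp add: D_def)
  ultimately show False by blast
qed

lemma reversed_imp_eq:
  assumes "p \<in> A" "q \<in> B" "q \<preceq> p"
  shows "p = q"
proof -
  have "fst q \<noteq> i + 1" using assms A(1) by (force simp: Q_def pair_le_def)
  then obtain p' where "p' \<in> A" "p' \<preceq> q" using exists_below[OF assms(2)] by blast
  then show ?thesis using antichain_between_eq[OF A(2) _ assms(1) _ assms(3)] by blast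
qed

text \<open>The level set of \<open>f\<close> at a nonzero value could be exchanged between the two antichains.\<close>

lemma constant_along_relations_eq_0:
  fixes f :: "nat \<times> nat \<Rightarrow> real"
  assumes const: "\<And>p q. p \<in> A - B \<Longrightarrow> q \<in> B - A \<Longrightarrow> p \<preceq> q \<Longrightarrow> f p = f q"
    and A0: "\<And>p. p \<in> A - B \<Longrightarrow> snd p = i + 1 \<Longrightarrow> f p = 0"
    and B0: "\<And>q. q \<in> B - A \<Longrightarrow> fst q = i + 1 \<Longrightarrow> f q = 0"
    and r: "r \<in> (A - B) \<union> (B - A)"
  shows "f r = 0"
proof (rule ccontr)
  assume "f r \<noteq> 0"
  define D where "D = {q \<in> B - A. f q = f r}"
  define E where "E = {p \<in> A - B. f p = f r}"
  have "fst q \<noteq> i + 1" if "q \<in> D" for q using that B0[of q] \<open>f r \<noteq> 0\<close> by (auto simp: D_def)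
  then have DQ: "D \<subseteq> Q m i" using B(1) by (force simp: D_def Q_def)
  have "snd p \<noteq> i + 1" if "p \<in> E" for p using that A0[of p] \<open>f r \<noteq> 0\<close> by (auto simp: E_def)
  then have EQ: "E \<subseteq> Q m (i + 1)" using A(1) by (force simp: E_def Q_def)
  have "\<not> p \<preceq> q \<and> \<not> q \<preceq> p" if "p \<in> A - E" "q \<in> D" for p q
    using that const[of p q] reversed_imp_eq[of p q] antichainD[OF B(2), of p q]
    by (auto simp: D_def E_def)
  then have "antichain (A - E \<union> D)"
    using antichainD[OF A(2)] antichainD[OF B(2)] unfolding antichain_def D_def by blast
  moreover have "\<not> p \<preceq> q \<and> \<not> q \<preceq> p" if "p \<in> E" "q \<in> B - D" for p q
    using that const[of p q] reversed_imp_eq[of p q] antichainD[OF A(2), of p q]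
    by (fastforce simp: D_def E_def)
  then have "antichain (B - D \<union> E)"
    using antichainD[OF A(2)] antichainD[OF B(2)] unfolding antichain_def E_def by blast
  ultimately have "D = {}" "E = {}"
    using no_exchange[of D E] DQ EQ by (auto simp: D_def E_def)
  then show False using r unfolding D_def E_def by blast
qed

lemma exists_above:
  assumes "p \<in> A" "snd p \<noteq> i + 1"
  shows "\<exists>q\<in>B. p \<preceq> q"
proof (rule ccontr)
  assume none: "\<not> ?thesis"
  then have "p \<notin> B" by auto
  define f :: "nat \<times> nat \<Rightarrow> real" where "f r = of_bool (r = p)" for r
  have "f p = 0"
    by (rule constant_along_relations_eq_0) (use assms none \<open>p \<notin> B\<close> in \<open>auto simp: f_def\<close>)
  then show False by (simp add: f_def)
qed

end

section \<open>Compatible tuples of antichains give vertices\<close>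

locale compatible_antichains =
  fixes m N :: nat and A :: "nat \<Rightarrow> (nat \<times> nat) set"
  assumes sub: "i \<in> {1..N} \<Longrightarrow> A i \<subseteq> Q m i"
    and anti: "i \<in> {1..N} \<Longrightarrow> antichain (A i)"
    and vertex: "i \<in> {1..<N} \<Longrightarrow>
      (chi (A i) + chi (A (i + 1))) extreme_point_of FFLV_A m (omega_pair i)"
begin

lemma consecutive_vertex_pair: "i \<in> {1..<N} \<Longrightarrow> antichain_vertex_pair m i (A i) (A (i + 1))"
  by unfold_locales (use sub anti vertex in auto)

lemma in_Q: "i \<in> {1..N} \<Longrightarrow> p \<in> A i \<Longrightarrow> p \<in> Q m i"
  using sub by blast

lemma in_pairsA: "i \<in> {1..N} \<Longrightarrow> p \<in> A i \<Longrightarrow> p \<in> pairsA m"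
  using in_Q Q_subset_pairsA by blast

text \<open>
  The two halves of a chain that meets \<open>A k\<close> for a range \<open>r \<le> k \<le> s\<close> and is cut at \<open>p \<in> A i\<close>: the
  part below \<open>p\<close> fits behind the position \<open>(r, r)\<close>, the part above \<open>p\<close> before \<open>(s + 1, s + 1)\<close>.
\<close>

definition lower_half :: "nat \<Rightarrow> nat \<times> nat \<Rightarrow> (nat \<times> nat) set \<Rightarrow> bool" where
  "lower_half i p S \<longleftrightarrow> S \<subseteq> pairsA m \<and> pair_chain S \<and> p \<in> S \<and> (\<forall>u\<in>S. u \<preceq> p) \<and>
     (\<exists>r\<ge>1. (\<forall>u\<in>S. r \<le> fst u) \<and> (\<forall>k\<in>{r..i}. S \<inter> A k \<noteq> {}))"

definition upper_half :: "nat \<Rightarrow> nat \<times> nat \<Rightarrow> (nat \<times> nat) set \<Rightarrow> bool" where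
  "upper_half i p S \<longleftrightarrow> S \<subseteq> pairsA m \<and> pair_chain S \<and> p \<in> S \<and> (\<forall>u\<in>S. p \<preceq> u) \<and>
     (\<exists>s<m. (\<forall>u\<in>S. snd u \<le> s + 1) \<and> (\<forall>k\<in>{i..min s N}. S \<inter> A k \<noteq> {}))"

lemma lower_half_singleton:
  assumes "i \<in> {1..N}" "p \<in> A i" "fst p = i"
  shows "lower_half i p {p}"
  using assms in_pairsA
  by (auto simp: lower_half_def Complete_Partial_Order.chain_def intro!: exI[of _ i])

lemma upper_half_singleton:
  assumes "i \<in> {1..N}" "p \<in> A i" "snd p = i + 1 \<or> i = N"
  shows "upper_half i p {p}"
proof -
  have "p \<in> pairsA m" using assms in_pairsA by blast
  moreover have "p \<in> A k" if "k \<in> {i..min (snd p - 1) N}" for k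
    using that assms by (cases "k = i") auto
  ultimately show ?thesis using assms(2)
    by (auto simp: upper_half_def Complete_Partial_Order.chain_def pairsA_def
        intro!: exI[of _ "snd p - 1"])
qed

lemma lower_half_insert:
  assumes S: "lower_half i q S" and p: "p \<in> A (Suc i)" "p \<in> pairsA m" "q \<preceq> p"
  shows "lower_half (Suc i) p (insert p S)"
proof -
  obtain r where r: "1 \<le> r" "\<And>u. u \<in> S \<Longrightarrow> r \<le> fst u" "\<And>k. k \<in> {r..i} \<Longrightarrow> S \<inter> A k \<noteq> {}"
    using S unfolding lower_half_def by blast
  have le: "u \<preceq> p" if "u \<in> S" for u
    using S p(3) that pair_le_trans unfolding lower_half_def by blast
  have "r \<le> fst p" using S r(2)[of q] p(3) by (auto simp: lower_half_def pair_le_def)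
  moreover have "insert p S \<inter> A k \<noteq> {}" if "k \<in> {r..Suc i}" for k
    using that r(3)[of k] p(1) by (cases "k = Suc i") auto
  moreover have "pair_chain (insert p S)"
    using S le by (auto simp: lower_half_def Complete_Partial_Order.chain_def)
  ultimately show ?thesis
    using S p(2) r(1,2) le unfolding lower_half_def by (intro conjI exI[of _ r]) auto
qed

lemma upper_half_insert:
  assumes S: "upper_half (Suc i) q S" and p: "p \<in> A i" "p \<in> pairsA m" "p \<preceq> q"
  shows "upper_half i p (insert p S)"
proof -
  obtain s where s: "s < m" "\<And>u. u \<in> S \<Longrightarrow> snd u \<le> s + 1" "\<And>k. k \<in> {Suc i..min s N} \<Longrightarrow> S \<inter> A k \<noteq> {}"
    using S unfolding upper_half_def by blast
  have le: "p \<preceq> u" if "u \<in> S" for u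
    using S p(3) that pair_le_trans unfolding upper_half_def by blast
  have "snd p \<le> s + 1" using S s(2)[of q] p(3) by (auto simp: upper_half_def pair_le_def)
  moreover have "insert p S \<inter> A k \<noteq> {}" if "k \<in> {i..min s N}" for k
    using that s(3)[of k] p(1) by (cases "k = i") auto
  moreover have "pair_chain (insert p S)"
    using S le by (auto simp: upper_half_def Complete_Partial_Order.chain_def)
  ultimately show ?thesis
    using S p(2) s(1,2) le unfolding upper_half_def by (intro conjI exI[of _ s]) auto
qed

lemma lower_half_exists:
  assumes "i \<in> {1..N}" "p \<in> A i"
  shows "\<exists>S. lower_half i p S"
  using assms
proof (induction i arbitrary: p)
  case (Suc i)
  show ?case
  proof (cases "fst p = Suc i")
    case True
    then show ?thesis using lower_half_singleton Suc.prems by blast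
  next
    case False
    then have i: "i \<in> {1..<N}" using in_Q[OF Suc.prems] Suc.prems(1) by (auto simp: Q_def)
    then interpret antichain_vertex_pair m i "A i" "A (i + 1)" by (rule consecutive_vertex_pair)
    obtain q where q: "q \<in> A i" "q \<preceq> p" using exists_below[of p] Suc.prems(2) False by auto
    then obtain S where "lower_half i q S" using Suc.IH i by fastforce
    then show ?thesis using lower_half_insert Suc.prems in_pairsA q(2) by blast
  qed
qed simp

lemma upper_half_exists:
  assumes "i \<in> {1..N}" "p \<in> A i"
  shows "\<exists>S. upper_half i p S"
proof -
  have "i \<le> N" using assms by simp
  then show ?thesis using assms
  proof (induction i arbitrary: p rule: inc_induct)
    case base
    then show ?case using upper_half_singleton by blast
  next
    case (step i)
    show ?case
    proof (cases "snd p = i + 1")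
      case True
      then show ?thesis using upper_half_singleton step.prems by blast
    next
      case False
      have i: "i \<in> {1..<N}" using step by auto
      then interpret antichain_vertex_pair m i "A i" "A (i + 1)" by (rule consecutive_vertex_pair)
      obtain q where q: "q \<in> A (Suc i)" "p \<preceq> q" using exists_above[of p] step.prems(2) False by auto
      then obtain S where "upper_half (Suc i) q S" using step.IH i by fastforce
      then show ?thesis using upper_half_insert step.prems in_pairsA q(2) by blast
    qed
  qed
qed

context
  fixes v :: "nat \<times> nat \<Rightarrow> real"
  assumes support: "v p \<noteq> 0 \<Longrightarrow> \<exists>k\<in>{1..N}. p \<in> A k"
    and tight: "lattice_path m (r, r + 1) (s, s + 1) d \<Longrightarrow> \<forall>k\<in>{r..min s N}. set d \<inter> A k \<noteq> {} \<Longrightarrow>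
      (\<Sum>p\<in>set d. v p) = 0"
begin

lemma sum_over_tight_chain:
  assumes C: "C \<subseteq> pairsA m" "pair_chain C" "C \<noteq> {}" "\<forall>k\<in>{r..min s N}. C \<inter> A k \<noteq> {}"
    and rs: "1 \<le> r" "s < m" "\<And>u. u \<in> C \<Longrightarrow> r \<le> fst u \<and> snd u \<le> s + 1"
  shows "(\<Sum>p\<in>C. v p) = 0"
proof -
  have u: "(r, r + 1) \<preceq> u" "u \<preceq> (s, s + 1)" if "u \<in> C" for u
    using rs(3)[OF that] C(1) that by (auto simp: pair_le_def pairsA_def)
  obtain u0 where "u0 \<in> C" using C(3) by blast
  then have "r \<le> s" using u[of u0] by (auto simp: pair_le_def)
  then obtain d where d: "lattice_path m (r, r + 1) (s, s + 1) d" "C \<subseteq> set d"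
    using lattice_path_through_chain[of C m "(r, r + 1)" "(s, s + 1)"] C(1,2) rs(1,2) u
      finite_subset[OF C(1) finite_pairsA] by (auto simp: pairsA_def pair_le_def)
  have "v u = 0" if "u \<in> set d - C" for u
  proof (rule ccontr)
    assume "v u \<noteq> 0"
    then obtain k where k: "k \<in> {1..N}" "u \<in> A k" using support by blast
    then have "k \<in> {r..min s N}"
      using in_Q[OF k] lattice_path_between[OF d(1), of u] that by (auto simp: Q_def pair_le_def)
    then obtain u' where "u' \<in> C \<inter> A k" using C(4) by blast
    then have "u' = u"
      using pair_chain_meets_antichain_once[OF lattice_path_chain[OF d(1)] anti[OF k(1)], of u' u]
        d(2) that k(2) by blast
    then show False using that \<open>u' \<in> C \<inter> A k\<close> by blast
  qed
  then have "(\<Sum>p\<in>C. v p) = (\<Sum>p\<in>set d. v p)"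
    using d(2) by (intro sum.mono_neutral_left) auto
  moreover have "\<forall>k\<in>{r..min s N}. set d \<inter> A k \<noteq> {}" using C(4) d(2) by blast
  ultimately show ?thesis using tight[OF d(1)] by simp
qed

lemma sum_over_halves:
  assumes S: "lower_half i p S" and T: "upper_half j q T" and "p \<preceq> q" "j \<le> i + 1"
  shows "(\<Sum>u\<in>S. v u) + (\<Sum>u\<in>T. v u) = (if p = q then v p else 0)"
proof -
  obtain r where r: "1 \<le> r" "\<forall>u\<in>S. r \<le> fst u" "\<forall>k\<in>{r..i}. S \<inter> A k \<noteq> {}"
    using S by (auto simp: lower_half_def)
  obtain s where s: "s < m" "\<forall>u\<in>T. snd u \<le> s + 1" "\<forall>k\<in>{j..min s N}. T \<inter> A k \<noteq> {}"
    using T by (auto simp: upper_half_def)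
  have S': "S \<subseteq> pairsA m" "pair_chain S" "p \<in> S" "\<And>u. u \<in> S \<Longrightarrow> u \<preceq> p"
    using S by (auto simp: lower_half_def)
  have T': "T \<subseteq> pairsA m" "pair_chain T" "q \<in> T" "\<And>u. u \<in> T \<Longrightarrow> q \<preceq> u"
    using T by (auto simp: upper_half_def)
  have ST: "u \<preceq> u'" if "u \<in> S" "u' \<in> T" for u u'
    using S'(4)[OF that(1)] T'(4)[OF that(2)] \<open>p \<preceq> q\<close> pair_le_trans by blast
  have "(\<Sum>u\<in>S \<union> T. v u) = 0"
  proof (rule sum_over_tight_chain[OF _ _ _ _ r(1) s(1)])
    show "pair_chain (S \<union> T)"
      using S'(2) T'(2) ST by (auto simp: Complete_Partial_Order.chain_def)
    show "r \<le> fst u \<and> snd u \<le> s + 1" if "u \<in> S \<union> T" for u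
      using that r(2) s(2) S'(3) T'(3) ST[of u q] ST[of p u] by (fastforce simp: pair_le_def)
    show "\<forall>k\<in>{r..min s N}. (S \<union> T) \<inter> A k \<noteq> {}"
    proof
      fix k assume "k \<in> {r..min s N}"
      then have "k \<in> {r..i} \<or> k \<in> {j..min s N}" using \<open>j \<le> i + 1\<close> by auto
      then show "(S \<union> T) \<inter> A k \<noteq> {}" using r(3) s(3) by blast
    qed
  qed (use S' T' in auto)
  moreover have "u = p \<and> p = q" if "u \<in> S \<inter> T" for u
    using that S'(4)[of u] T'(4)[of u] \<open>p \<preceq> q\<close> pair_le_trans pair_le_antisym by blast
  then have "S \<inter> T = (if p = q then {p} else {})" using S'(3) T'(3) by auto
  moreover have "finite S" "finite T" using S'(1) T'(1) finite_pairsA finite_subset by blast+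
  ultimately show ?thesis using sum.union_inter[of S T v] by (cases "p = q") simp_all
qed

definition lower_sum :: "nat \<Rightarrow> nat \<times> nat \<Rightarrow> real" where
  "lower_sum i p = (\<Sum>u\<in>(SOME S. lower_half i p S). v u)"

definition upper_sum :: "nat \<Rightarrow> nat \<times> nat \<Rightarrow> real" where
  "upper_sum i p = (\<Sum>u\<in>(SOME S. upper_half i p S). v u)"

lemma lower_half_some: "i \<in> {1..N} \<Longrightarrow> p \<in> A i \<Longrightarrow> lower_half i p (SOME S. lower_half i p S)"
  using lower_half_exists by (rule someI_ex)

lemma upper_half_some: "i \<in> {1..N} \<Longrightarrow> p \<in> A i \<Longrightarrow> upper_half i p (SOME S. upper_half i p S)"
  using upper_half_exists by (rule someI_ex)

lemma lower_sum_add_upper_sum: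
  assumes "i \<in> {1..N}" "p \<in> A i" "j \<in> {1..N}" "q \<in> A j" "p \<preceq> q" "j \<le> i + 1"
  shows "lower_sum i p + upper_sum j q = (if p = q then v p else 0)"
  unfolding lower_sum_def upper_sum_def
  using sum_over_halves lower_half_some upper_half_some assms by blast

lemma upper_sum_initial:
  assumes "i \<in> {1..N}" "p \<in> A i" "fst p = i"
  shows "upper_sum i p = 0"
  using sum_over_halves[OF lower_half_singleton upper_half_some, of i p i p] assms
  by (simp add: upper_sum_def)

lemma lower_sum_final:
  assumes "i \<in> {1..N}" "p \<in> A i" "snd p = i + 1 \<or> i = N"
  shows "lower_sum i p = 0"
  using sum_over_halves[OF lower_half_some upper_half_singleton, of i p i p] assms
  by (simp add: lower_sum_def)

lemma half_sums_at_symmetric_difference: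
  assumes i: "i \<in> {1..<N}"
  shows "p \<in> A i - A (i + 1) \<Longrightarrow> lower_sum i p = 0"
    and "p \<in> A (i + 1) - A i \<Longrightarrow> upper_sum (i + 1) p = 0"
proof -
  interpret antichain_vertex_pair m i "A i" "A (i + 1)" using i by (rule consecutive_vertex_pair)
  define f where "f p = (if p \<in> A i then lower_sum i p else - upper_sum (i + 1) p)" for p
  have f: "f r = 0" if "r \<in> (A i - A (i + 1)) \<union> (A (i + 1) - A i)" for r
  proof (rule constant_along_relations_eq_0[OF _ _ _ that])
    fix p q assume pq: "p \<in> A i - A (i + 1)" "q \<in> A (i + 1) - A i" "p \<preceq> q"
    then have "p \<noteq> q" by blast
    then show "f p = f q"
      using lower_sum_add_upper_sum[of i p "i + 1" q] pq i by (simp add: f_def)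
  next
    fix p assume "p \<in> A i - A (i + 1)" "snd p = i + 1"
    then show "f p = 0" using lower_sum_final[of i p] i by (auto simp: f_def)
  next
    fix q assume "q \<in> A (i + 1) - A i" "fst q = i + 1"
    then show "f q = 0" using upper_sum_initial[of "i + 1" q] i by (auto simp: f_def)
  qed
  show "p \<in> A i - A (i + 1) \<Longrightarrow> lower_sum i p = 0" using f[of p] by (auto simp: f_def)
  show "p \<in> A (i + 1) - A i \<Longrightarrow> upper_sum (i + 1) p = 0" using f[of p] by (auto simp: f_def)
qed

lemma upper_sum_eq_0: "i \<in> {1..N} \<Longrightarrow> p \<in> A i \<Longrightarrow> upper_sum i p = 0"
proof (induction i)
  case (Suc i)
  consider "i = 0" | "i \<in> {1..<N}" "p \<in> A i" | "i \<in> {1..<N}" "p \<notin> A i"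
    using Suc.prems by fastforce
  then show ?case
  proof cases
    case 1
    then have "fst p = Suc i" using in_Q[OF Suc.prems] by (auto simp: Q_def)
    then show ?thesis using upper_sum_initial Suc.prems by blast
  next
    case 2
    then show ?thesis
      using lower_sum_add_upper_sum[of i p i p] lower_sum_add_upper_sum[of i p "i + 1" p] Suc
      by auto
  next
    case 3
    then show ?thesis using half_sums_at_symmetric_difference(2)[of i p] Suc.prems by auto
  qed
qed simp

lemma lower_sum_eq_0:
  assumes "i \<in> {1..N}" "p \<in> A i"
  shows "lower_sum i p = 0"
proof -
  have "i \<le> N" using assms by simp
  then show ?thesis using assms
  proof (induction i rule: inc_induct)
    case base
    then show ?case using lower_sum_final by blast
  next
    case (step i)
    then have i: "i \<in> {1..<N}" by auto
    show ?case
    proof (cases "p \<in> A (i + 1)")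
      case True
      then show ?thesis
        using lower_sum_add_upper_sum[of i p "i + 1" p]
          lower_sum_add_upper_sum[of "i + 1" p "i + 1" p] step i by auto
    next
      case False
      then show ?thesis using half_sums_at_symmetric_difference(1)[OF i, of p] step.prems by auto
    qed
  qed
qed

lemma tight_direction_eq_0: "v p = 0"
proof (rule ccontr)
  assume "v p \<noteq> 0"
  then obtain k where k: "k \<in> {1..N}" "p \<in> A k" using support by blast
  have "lower_sum k p + upper_sum k p = v p" using lower_sum_add_upper_sum[OF k k] by simp
  then show False using lower_sum_eq_0[OF k] upper_sum_eq_0[OF k] \<open>v p \<noteq> 0\<close> by simp
qed

end

lemma boundA_le_path_sum_sum_chi:
  assumes b: "\<And>k. N < k \<Longrightarrow> b k = 0"
    and d: "lattice_path m (r, r + 1) (s, s + 1) d" and meets: "\<forall>k\<in>{r..min s N}. set d \<inter> A k \<noteq> {}"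
  shows "real (boundA b d) \<le> path_sum (\<Sum>i=1..N. real (b i) *\<^sub>R chi (A i)) d"
proof -
  have r: "1 \<le> r" using lattice_path_endpoints(3)[OF d] by (simp add: pairsA_def)
  have "real (boundA b d) = (\<Sum>k=r..s. real (b k))"
    using d by (simp add: boundA_def lattice_path_def)
  also have "\<dots> = (\<Sum>k=r..min s N. real (b k) * of_bool (set d \<inter> A k \<noteq> {}))"
    using b meets by (intro sum.mono_neutral_cong_right) auto
  also have "\<dots> \<le> (\<Sum>k=1..N. real (b k) * of_bool (set d \<inter> A k \<noteq> {}))"
    using r by (intro sum_mono2) auto
  also have "\<dots> = path_sum (\<Sum>i=1..N. real (b i) *\<^sub>R chi (A i)) d"
    using d anti finite_subset[OF sub finite_Q]
    by (intro path_sum_sum_chi[symmetric]) (auto simp: lattice_path_def)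
  finally show ?thesis .
qed

lemma extreme_point_sum_chi:
  assumes b: "\<And>k. N < k \<Longrightarrow> b k = 0"
  shows "(\<Sum>i=1..N. real (b i) *\<^sub>R chi (A i)) extreme_point_of FFLV_A m b"
proof (rule FFLV_A.extreme_point_if_tight_directions_zero)
  let ?x = "\<Sum>i=1..N. real (b i) *\<^sub>R chi (A i)"
  show x: "?x \<in> FFLV_A m b" using sub anti by (intro sum_chi_in_FFLV_A) auto
  fix v assume v: "v \<in> coord_space (pairsA m)"
    and tight: "\<And>l c. (l, c) \<in> FFLV_A_constraints m b \<Longrightarrow> l ?x = c \<Longrightarrow> l v = 0"
  have "coeff_at v p = 0" for p
  proof (rule tight_direction_eq_0[where v = "coeff_at v"])
    fix p assume ne: "coeff_at v p \<noteq> 0"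
    then have "p \<in> pairsA m" using coeff_at_eq_0[OF v] by blast
    then have "coeff_at ?x p \<noteq> 0"
      using tight[of "\<lambda>x. - coeff_at x p" 0] ne by (auto simp: FFLV_A_constraints_def)
    moreover have "coeff_at ?x p = (\<Sum>i=1..N. real (b i) * indicator (A i) p)"
      using finite_subset[OF sub finite_Q] by (rule coeff_at_sum_chi)
    ultimately show "\<exists>k\<in>{1..N}. p \<in> A k"
      by (metis (no_types, lifting) indicator_simps(2) mult_zero_right sum.neutral)
  next
    fix r s d
    assume d: "lattice_path m (r, r + 1) (s, s + 1) d" "\<forall>k\<in>{r..min s N}. set d \<inter> A k \<noteq> {}"
    have "dyck_pathA m d" using d(1) by (rule lattice_path_dyck_pathA)
    then have "path_sum ?x d = real (boundA b d)"
      using boundA_le_path_sum_sum_chi[OF b d] x by (fastforce simp: FFLV_A_def)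
    then have "path_sum v d = 0"
      using tight[of "\<lambda>x. path_sum x d" "real (boundA b d)"] \<open>dyck_pathA m d\<close>
      by (auto simp: FFLV_A_constraints_def)
    then show "(\<Sum>p\<in>set d. coeff_at v p) = 0" by (simp add: path_sum_def)
  qed
  then show "v = 0" by (auto intro: poly_mapping_eqI)
qed

end

theorem extreme_point_FFLV_A_iff:
  assumes "N < m" and b: "\<And>k. N < k \<Longrightarrow> b k = 0" and x: "x \<in> coord_space S"
  shows "x extreme_point_of FFLV_A m b \<longleftrightarrow>
    (\<exists>A. (\<forall>i\<in>{1..N}. A i \<subseteq> Q m i \<inter> S \<and> antichain (A i)) \<and>
       (\<forall>i\<in>{1..<N}. (chi (A i) + chi (A (i + 1))) extreme_point_of FFLV_A m (omega_pair i)) \<and>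
       x = (\<Sum>i=1..N. real (b i) *\<^sub>R chi (A i)))"
    (is "_ \<longleftrightarrow> (\<exists>A. ?decomposition A)")
proof
  assume "x extreme_point_of FFLV_A m b"
  then obtain A where A: "\<And>i. A i \<subseteq> Q m i \<inter> S \<and> antichain (A i)"
    "\<And>i. 1 \<le> i \<Longrightarrow> i + 1 < m \<Longrightarrow> (chi (A i) + chi (A (i + 1))) extreme_point_of FFLV_A m (omega_pair i)"
    "x = (\<Sum>i=1..<m. real (b i) *\<^sub>R chi (A i))"
    using FFLV_A_vertex_decomposition x by blast
  have "(\<Sum>i=1..<m. real (b i) *\<^sub>R chi (A i)) = (\<Sum>i=1..N. real (b i) *\<^sub>R chi (A i))"
    using \<open>N < m\<close> b by (intro sum.mono_neutral_right) auto
  then show "\<exists>A. ?decomposition A" using A \<open>N < m\<close> by (intro exI[of _ A]) auto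
next
  assume "\<exists>A. ?decomposition A"
  then obtain A where A: "?decomposition A" ..
  interpret compatible_antichains m N A
    by unfold_locales (use A in auto)
  show "x extreme_point_of FFLV_A m b" using A extreme_point_sum_chi b by auto
qed

section \<open>The type C polytope as a face of a type A polytope\<close>

definition truncate_weight :: "nat \<Rightarrow> weight \<Rightarrow> weight" where
  "truncate_weight n a k = (if k \<le> n then a k else 0)"

lemma pairsC_subset_pairsA: "pairsC n \<subseteq> pairsA (2 * n)"
  by (auto simp: pairsC_def pairsA_def)

lemma pairsC_iff: "p \<in> pairsC n \<longleftrightarrow> p \<in> pairsA (2 * n) \<and> fst p + snd p \<le> 2 * n + 1"
  by (auto simp: pairsC_def pairsA_def)

lemma boundA_truncate_le: "fst (last d) \<le> n \<Longrightarrow> boundA (truncate_weight n a) d = boundA a d"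
  by (auto simp: boundA_def truncate_weight_def intro!: sum.cong)

lemma boundA_truncate_ge:
  "n \<le> fst (last d) \<Longrightarrow> boundA (truncate_weight n a) d = (\<Sum>k=fst (hd d)..n. a k)"
  unfolding boundA_def by (intro sum.mono_neutral_cong_right) (auto simp: truncate_weight_def)

lemma boundC_diagonal: "snd (last d) = fst (last d) + 1 \<Longrightarrow> boundC n a d = boundA a d"
  by (simp add: boundC_def boundA_def)

lemma boundC_antidiagonal:
  assumes "fst (last d) + snd (last d) = 2 * n + 1"
  shows "boundC n a d = (\<Sum>k=fst (hd d)..n. a k)"
proof -
  have "fst (last d) = n" if "snd (last d) = fst (last d) + 1" using assms that by simp
  then show ?thesis by (simp add: boundC_def)
qed

lemma dyck_pathA_restrict_pairsC:
  assumes d: "dyck_pathA (2 * n) d" and meets: "set d \<inter> pairsC n \<noteq> {}"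
  obtains c where "dyck_pathC n c" "set c = set d \<inter> pairsC n"
    "boundC n a c = boundA (truncate_weight n a) d"
proof -
  define P where "P p \<longleftrightarrow> fst p + snd p \<le> 2 * n + 1" for p :: "nat \<times> nat"
  define c e where "c = takeWhile P d" and "e = dropWhile P d"
  have dce: "d = c @ e" by (simp add: c_def e_def)
  have steps: "successively dyck_step d" "successively dyck_step c" "successively dyck_step e"
    using d by (auto simp: dyck_pathA_def dce successively_append_iff)
  have hd_e: "\<not> P (hd e)" if "e \<noteq> []" using that hd_dropWhile[of P d] by (simp add: e_def)
  then have "\<not> P p" if "p \<in> set e" for p
    using that dyck_steps_hd_le[OF steps(3) that] by (fastforce simp: P_def pair_le_def)
  moreover have "P p" if "p \<in> set c" for p
    using that by (auto simp: c_def dest: set_takeWhileD)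
  ultimately have set_c: "set c = set d \<inter> pairsC n"
    using d by (auto simp: pairsC_iff dyck_pathA_def P_def dce)
  then have ne: "c \<noteq> []" using meets by auto
  then have ends: "hd c = hd d" "last c \<in> pairsC n" "snd (hd d) = fst (hd d) + 1"
    "snd (last d) = fst (last d) + 1"
    using set_c d by (auto simp: dce dyck_pathA_def)
  have "dyck_pathC n c \<and> boundC n a c = boundA (truncate_weight n a) d"
  proof (cases "e = []")
    case True
    then have cd: "c = d" by (simp add: dce)
    then have "fst (last d) \<le> n" using ends by (auto simp: pairsC_def)
    then show ?thesis
      using d set_c ends unfolding cd
      by (auto simp: dyck_pathA_def dyck_pathC_def boundC_diagonal boundA_truncate_le)
  next
    case False
    have "dyck_step (last c) (hd e)"
      using steps(1) ne False by (auto simp: dce successively_append_iff)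
    then have antidiagonal: "fst (last c) + snd (last c) = 2 * n + 1"
      using hd_e[OF False] ends(2) by (auto simp: P_def dyck_step_def pairsC_def)
    have "last c \<preceq> last d" using dyck_steps_le_last[OF steps(1)] ne by (simp add: dce)
    then have "n \<le> fst (last d)" using antidiagonal ends(4) by (simp add: pair_le_def)
    then show ?thesis
      using antidiagonal ne steps set_c ends
      by (simp add: dyck_pathC_def boundC_antidiagonal boundA_truncate_ge)
  qed
  then show thesis using that[of c] set_c by blast
qed

lemma dyck_pathC_extend:
  assumes c: "dyck_pathC n c"
  obtains d where "dyck_pathA (2 * n) d" "set c = set d \<inter> pairsC n"
    "boundA (truncate_weight n a) d = boundC n a c"
proof -
  have c': "c \<noteq> []" "set c \<subseteq> pairsC n" "snd (hd c) = fst (hd c) + 1" "last c \<in> pairsC n"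
    using c by (auto simp: dyck_pathC_def)
  show thesis
  proof (cases "snd (last c) = fst (last c) + 1")
    case True
    then have "fst (last c) \<le> n" using c'(4) by (auto simp: pairsC_def)
    moreover have "dyck_pathA (2 * n) c"
      using c True pairsC_subset_pairsA by (auto simp: dyck_pathC_def dyck_pathA_def)
    ultimately show thesis
      using that[of c] c'(2) True by (auto simp: boundC_diagonal boundA_truncate_le)
  next
    case False
    define i where "i = fst (last c)"
    have last: "last c = (i, 2 * n + 1 - i)" "1 \<le> i" "i \<le> n"
      using c False c'(4) by (auto simp: dyck_pathC_def i_def pairsC_def prod_eq_iff)
    have "last c \<in> pairsA (2 * n)" "(2 * n - i, 2 * n + 1 - i) \<in> pairsA (2 * n)"
      "last c \<preceq> (2 * n - i, 2 * n + 1 - i)"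
      using last by (auto simp: pairsA_def pair_le_def)
    then obtain e where e: "lattice_path (2 * n) (last c) (2 * n - i, 2 * n + 1 - i) e"
      by (rule lattice_path_exists)
    have "lattice_path (2 * n) (hd c) (last c) c"
      using c pairsC_subset_pairsA by (auto simp: dyck_pathC_def lattice_path_def)
    then obtain d where d: "lattice_path (2 * n) (hd c) (2 * n - i, 2 * n + 1 - i) d"
      "set d = set c \<union> set e"
      using e by (rule lattice_path_append)
    have "u = last c" if "u \<in> set e" "u \<in> pairsC n" for u
      using lattice_path_between(1)[OF e that(1)] that(2) last
      by (auto simp: pair_le_def pairsC_def prod_eq_iff)
    then have "set c = set d \<inter> pairsC n" using c'(1,2) d(2) by fastforce
    moreover have "dyck_pathA (2 * n) d"
      using d(1) c'(3) last by (auto simp: dyck_pathA_def lattice_path_def)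
    moreover have "boundA (truncate_weight n a) d = boundC n a c"
      using d(1) last by (simp add: lattice_path_def boundA_truncate_ge boundC_antidiagonal)
    ultimately show thesis using that by blast
  qed
qed

lemma path_sum_restrict:
  assumes "x \<in> coord_space I" "set c = set d \<inter> I"
  shows "path_sum x d = path_sum x c"
  unfolding path_sum_def assms(2)
  using coeff_at_eq_0[OF assms(1)] by (intro sum.mono_neutral_right) auto

lemma FFLV_C_eq: "FFLV_C n a = FFLV_A (2 * n) (truncate_weight n a) \<inter> coord_space (pairsC n)"
proof (intro equalityI subsetI)
  fix x assume x: "x \<in> FFLV_C n a"
  then have xC: "x \<in> coord_space (pairsC n)" by (simp add: FFLV_C_def)
  have "0 \<le> coeff_at x p" for p
    using x coeff_at_eq_0[OF xC, of p] by (cases "p \<in> pairsC n") (auto simp: FFLV_C_def)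
  moreover have "path_sum x d \<le> real (boundA (truncate_weight n a) d)"
    if d: "dyck_pathA (2 * n) d" for d
  proof (cases "set d \<inter> pairsC n = {}")
    case True
    then show ?thesis using path_sum_restrict[OF xC, of "[]" d] by (simp add: path_sum_def)
  next
    case False
    then obtain c where "dyck_pathC n c" "set c = set d \<inter> pairsC n"
      "boundC n a c = boundA (truncate_weight n a) d"
      using dyck_pathA_restrict_pairsC[OF d] by blast
    then show ?thesis using x path_sum_restrict[OF xC, of c d] by (force simp: FFLV_C_def)
  qed
  ultimately show "x \<in> FFLV_A (2 * n) (truncate_weight n a) \<inter> coord_space (pairsC n)"
    using xC pairsC_subset_pairsA by (force simp: FFLV_A_def coord_space_def)
next
  fix x assume "x \<in> FFLV_A (2 * n) (truncate_weight n a) \<inter> coord_space (pairsC n)"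
  then have x: "x \<in> FFLV_A (2 * n) (truncate_weight n a)" and xC: "x \<in> coord_space (pairsC n)"
    by auto
  have "path_sum x c \<le> real (boundC n a c)" if c: "dyck_pathC n c" for c
  proof -
    obtain d where "dyck_pathA (2 * n) d" "set c = set d \<inter> pairsC n"
      "boundA (truncate_weight n a) d = boundC n a c"
      using dyck_pathC_extend[OF c] by blast
    then show ?thesis using x path_sum_restrict[OF xC, of c d] by (force simp: FFLV_A_def)
  qed
  then show "x \<in> FFLV_C n a"
    using xC FFLV_A_coeff_nonneg[OF x] by (simp add: FFLV_C_def)
qed

lemma extreme_point_FFLV_C_iff:
  "x extreme_point_of FFLV_C n a \<longleftrightarrow>
    x extreme_point_of FFLV_A (2 * n) (truncate_weight n a) \<and> x \<in> coord_space (pairsC n)"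
proof -
  have "FFLV_C n a face_of FFLV_A (2 * n) (truncate_weight n a)"
    unfolding FFLV_C_eq
    using FFLV_A.convex_solutions FFLV_A_coeff_nonneg by (rule coord_space_face_of)
  then show ?thesis
    using extreme_point_of_face[of "FFLV_C n a" _ x] FFLV_C_eq[of n a]
    by (metis Int_iff extreme_point_of_def)
qed

lemma QC_eq: "QC n i = Q (2 * n) i \<inter> pairsC n"
  by (auto simp: QC_def Q_def pairsC_def)

theorem theorem5p1:
  fixes n :: nat and a :: weight and x :: point
  assumes "1 \<le> n"
    and "x \<in> coord_space (pairsC n)"
  shows "x extreme_point_of FFLV_C n a \<longleftrightarrow>
    (\<exists>A :: nat \<Rightarrow> (nat \<times> nat) set.
       (\<forall>i\<in>{1..n}. A i \<subseteq> QC n i \<and> antichain (A i)) \<and>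
       (\<forall>i\<in>{1..<n}. (chi (A i) + chi (A (i + 1))) extreme_point_of
          FFLV_A (2 * n) (\<lambda>k. omegaA i k + omegaA (i + 1) k)) \<and>
       x = (\<Sum>i = 1..n. real (a i) *\<^sub>R chi (A i)))"
proof -
  let ?b = "truncate_weight n a"
  have "x extreme_point_of FFLV_C n a \<longleftrightarrow> x extreme_point_of FFLV_A (2 * n) ?b"
    using assms(2) by (simp add: extreme_point_FFLV_C_iff)
  moreover have "(\<Sum>i=1..n. real (?b i) *\<^sub>R chi (A i)) = (\<Sum>i=1..n. real (a i) *\<^sub>R chi (A i))" for A
    by (rule sum.cong) (simp_all add: truncate_weight_def)
  moreover have "n < 2 * n" "\<And>k. n < k \<Longrightarrow> ?b k = 0"
    using assms(1) by (simp_all add: truncate_weight_def)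
  ultimately show ?thesis
    using extreme_point_FFLV_A_iff[of n "2 * n" ?b x "pairsC n"] assms(2) by (simp only: QC_eq)
qed

end
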